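(* Let $d \ge 1$. For every Lebesgue measurable set $A \subset \mathbb{R}^d$ and every $t > 0$, one has $$K(t, \chi_A, L^1, \dot{BV}) = K(t, A),$$ and so in particular, for every $\alpha \in (0,1)$, $$\tilde{P}_\alpha(A) = \alpha(1-\alpha) \int_0^\infty t^{-\alpha} K(t, A) \, \frac{dt}{t}.$$
   Context: $|E|$ denotes the Lebesgue measure of a measurable set $E \subset \mathbb{R}^d$ and $\chi_E$ its characteristic function. For $f \in L^1_{\mathrm{loc}}(\mathbb{R}^d)$, $|Df|(\mathbb{R}^d) \in [0,\infty]$ denotes the total variation of its distributional gradient, that is, $|Df|(\mathbb{R}^d) = \sup\{ \int_{\mathbb{R}^d} f \operatorname{div}\Phi \, dx : \Phi \in C_c^\infty(\mathbb{R}^d;\mathbb{R}^d),\ |\Phi| \le 1 \}$. The homogeneous space $\dot{BV}(\mathbb{R}^d)$ consists of the functions $f \in L^1_{\mathrm{loc}}(\mathbb{R}^d)$ with $|Df|(\mathbb{R}^d) < \infty$. The perimeter (in the sense of De Giorgi) of a measurable set $E$ is $\operatorname{Per}(E) := |D\chi_E|(\mathbb{R}^d)$, and $E$ has finite perimeter if $\operatorname{Per}(E) < \infty$. For a measurable function $f$ and $t > 0$, the $K$-functional is $$K(t, f, L^1, \dot{BV}) := \inf_{f = f_1 + f_2} \|f_1\|_{L^1(\mathbb{R}^d)} + t\, |Df_2|(\mathbb{R}^d),$$ where the infimum is over all decompositions $f = f_1 + f_2$ with $f_1 \in L^1(\mathbb{R}^d)$ and $f_2 \in \dot{BV}(\mathbb{R}^d)$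 (with value $+\infty$ if no such decomposition exists). For a measurable set $A \subset \mathbb{R}^d$ and $t > 0$, the penalty functional is $$K(t, A) := \inf_{U \subset \mathbb{R}^d} |A \triangle U| + t \operatorname{Per}(U),$$ where the infimum is taken over all open sets $U \subset \mathbb{R}^d$ of finite perimeter and $A \triangle U := (A \setminus U) \cup (U \setminus A)$. Both functionals take values in $[0,\infty]$. For a measurable set $A \subset \mathbb{R}^d$ and $\alpha \in (0,1)$, the fractional perimeter intrinsic to interpolation is $$\tilde{P}_\alpha(A) := \alpha(1-\alpha) \int_0^\infty t^{-\alpha} K(t, \chi_A, L^1, \dot{BV}) \, \frac{dt}{t}.$$ *)

theory Defs
  imports "HOL-Analysis.Analysis"
begin

text \<open>Euclidean space of dimension \<open>d \<ge> 1\<close> is a type \<open>'a::euclidean_space\<close>; all measures and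
  integrals over it use the complete measure \<^const>\<open>lebesgue\<close>.\<close>

fun Ck :: "nat \<Rightarrow> ('a::euclidean_space \<Rightarrow> 'b::real_normed_vector) \<Rightarrow> bool" where
  "Ck 0 f \<longleftrightarrow> continuous_on UNIV f"
| "Ck (Suc k) f \<longleftrightarrow> (\<forall>x. f differentiable (at x)) \<and>
     (\<forall>v. Ck k (\<lambda>x. frechet_derivative f (at x) v))"

definition Cc_infty :: "('a::euclidean_space \<Rightarrow> 'b::real_normed_vector) set" where
  "Cc_infty = {\<Phi>. (\<forall>k. Ck k \<Phi>) \<and> compact (closure {x. \<Phi> x \<noteq> 0})}"

definition div_field :: "('a::euclidean_space \<Rightarrow> 'a) \<Rightarrow> 'a \<Rightarrow> real" where
  "div_field \<Phi> x = (\<Sum>b\<in>Basis. frechet_derivative \<Phi> (at x) b \<bullet> b)"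

definition loc_integrable :: "('a::euclidean_space \<Rightarrow> real) \<Rightarrow> bool" where
  "loc_integrable f \<longleftrightarrow> (\<forall>C. compact C \<longrightarrow> set_integrable lebesgue C f)"

text \<open>Total variation \<open>|Df|\<close> of the whole space, meaningful for locally integrable \<open>f\<close>.
  \<^const>\<open>ennreal\<close> sends negative integrals to 0; as \<open>\<Phi> = 0\<close> is admissible, this does not change
  the supremum.\<close>

definition total_var :: "('a::euclidean_space \<Rightarrow> real) \<Rightarrow> ennreal" where
  "total_var f =
     (SUP \<Phi>\<in>{\<Phi> \<in> Cc_infty. \<forall>x. norm (\<Phi> x) \<le> 1}. ennreal (LINT x|lebesgue. f x * div_field \<Phi> x))"

definition BV_dot :: "('a::euclidean_space \<Rightarrow> real) set" where
  "BV_dot = {f. loc_integrable f \<and> total_var f < \<infinity>}"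

definition perimeter :: "'a::euclidean_space set \<Rightarrow> ennreal" where
  "perimeter E = total_var (indicat_real E)"

text \<open>Functions are identified up to null sets, so \<open>f = f1 + f2\<close> is required almost everywhere.
  In both functionals the infimum of the empty set is \<open>\<infinity>\<close>.\<close>

definition K_functional :: "real \<Rightarrow> ('a::euclidean_space \<Rightarrow> real) \<Rightarrow> ennreal" where
  "K_functional t f =
     (INF (f1, f2) \<in> {(f1, f2). integrable lebesgue f1 \<and> f2 \<in> BV_dot \<and>
                               (AE x in lebesgue. f x = f1 x + f2 x)}.
        (\<integral>\<^sup>+x. ennreal \<bar>f1 x\<bar> \<partial>lebesgue) + ennreal t * total_var f2)"

definition K_penalty :: "real \<Rightarrow> 'a::euclidean_space set \<Rightarrow> ennreal" where
  "K_penalty t A =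
     (INF U \<in> {U. open U \<and> perimeter U < \<infinity>}.
        emeasure lebesgue (sym_diff A U) + ennreal t * perimeter U)"

definition frac_perimeter :: "real \<Rightarrow> 'a::euclidean_space set \<Rightarrow> ennreal" where
  "frac_perimeter \<alpha> A =
     ennreal (\<alpha> * (1 - \<alpha>)) *
       (\<integral>\<^sup>+t\<in>{0<..}. ennreal (t powr (- \<alpha>)) * K_functional t (indicat_real A) * ennreal (1 / t) \<partial>lborel)"

end

theory Submission
  imports Defs "HOL-Computational_Algebra.Polynomial"
begin

text \<open>An open set \<open>U\<close> of finite perimeter gives the decomposition
\<open>\<chi>\<^sub>A = (\<chi>\<^sub>A - \<chi>\<^sub>U) + \<chi>\<^sub>U\<close>, whose cost is \<open>|A \<triangle> U| + t Per U\<close>; so the \<open>K\<close>-functional is at most the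
penalty functional.

For the converse let \<open>\<chi>\<^sub>A = f\<^sub>1 + f\<^sub>2\<close>. The competitors are the superlevel sets \<open>{f\<^sub>2 > s}\<close> with
\<open>0 < s < 1\<close>. Averaged over \<open>s\<close>, their perimeters contribute at most \<open>|Df\<^sub>2|\<close> (coarea), and since \<open>\<chi>\<^sub>A\<close>
takes only the values 0 and 1, the measures \<open>|A \<triangle> {f\<^sub>2 > s}|\<close> contribute at most \<open>\<parallel>\<chi>\<^sub>A - f\<^sub>2\<parallel>\<^sub>1 = \<parallel>f\<^sub>1\<parallel>\<^sub>1\<close>
(layer cake). The infimum over \<open>s\<close> is below the average.

The superlevel sets of \<open>f\<^sub>2\<close> itself need not be open. They become open when \<open>f\<^sub>2\<close> is replaced by a
mollification \<open>h\<close> at scale \<open>\<epsilon>\<close>, which is smooth, and then the coarea inequality is elementary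
(\<open>coarea_inequality\<close>): testing with \<open>S(n(h - s))\<close>, where \<open>S\<close> rises smoothly from 0 to 1 on the positive
half line, bounds \<open>Per {h > s}\<close> by the lower limit of the integrals of \<open>n S'(n(h - s)) |\<nabla>h|\<close>, and the
weights \<open>n S'(n(c - s))\<close> have integral at most 1 in \<open>s\<close>; Fatou's lemma and Tonelli's theorem finish.

The mollification costs nothing in the limit because of two estimates. First, \<open>\<integral>|\<nabla>h| \<le> |Df\<^sub>2|\<close>
(\<open>integral_norm_gradient_mollified_le\<close>): mollification moves onto the test field, and a merely measurable
field such as \<open>\<nabla>h / |\<nabla>h|\<close>, cut off to a ball, becomes admissible after mollification. Second,
\<open>\<parallel>h - f\<^sub>2\<parallel>\<^sub>1 \<le> \<epsilon> |Df\<^sub>2|\<close> (\<open>mollified_L1_distance\<close>), which is an average of the translation estimate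
\<open>\<parallel>f(\<sqdot> + z) - f\<parallel>\<^sub>1 \<le> |z| |Df|\<close> (\<open>total_var_translation\<close>). That one follows from the mean value theorem
applied to \<open>s \<mapsto> \<integral> f g(\<sqdot> - s z)\<close> for smooth \<open>g\<close>, whose derivative is a divergence tested against \<open>f\<close>;
the \<open>L\<^sup>1\<close> norm is recovered by letting \<open>g\<close> approach a sign function almost everywhere.

Functions that enter product integrals are taken Borel measurable and integrated against
\<open>lborel\<close>; every locally integrable function has such a version with the same total variation.\<close>

section \<open>Differentiation rules for C^k functions\<close>

lemma Ck_has_derivative:
  "Ck (Suc k) f \<Longrightarrow> (f has_derivative frechet_derivative f (at x)) (at x)"
  by (simp add: frechet_derivative_works[symmetric])

text \<open>An explicit derivative is easier to differentiate further than \<^const>\<open>frechet_derivative\<close>; this rule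
is the introduction form used for every closure property below.\<close>

lemma Ck_SucI:
  assumes "\<And>x. (f has_derivative f' x) (at x)" "\<And>v. Ck k (\<lambda>x. f' x v)"
  shows "Ck (Suc k) f"
proof -
  have "frechet_derivative f (at x) = f' x" for x
    using frechet_derivative_at[OF assms(1)] by simp
  then show ?thesis
    using assms by (auto simp: differentiable_def)
qed

lemma Ck_SucD: "Ck (Suc k) f \<Longrightarrow> Ck k f"
proof (induction k arbitrary: f)
  case 0
  then show ?case
    by (auto intro!: differentiable_imp_continuous_on simp: differentiable_on_def
        intro: differentiable_at_withinI)
next
  case (Suc k)
  then show ?case by (metis Ck.simps(2))
qed

lemma Ck_continuous: "Ck k f \<Longrightarrow> continuous_on UNIV f"
  by (induction k arbitrary: f) (auto dest: Ck_SucD simp del: Ck.simps(2))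

lemma Ck_const [simp]: "Ck k (\<lambda>x. c)"
proof (induction k arbitrary: c)
  case (Suc k)
  show ?case by (rule Ck_SucI[where f'="\<lambda>x v. 0"]) (auto intro: Suc)
qed auto

lemma Ck_add: "Ck k f \<Longrightarrow> Ck k g \<Longrightarrow> Ck k (\<lambda>x. f x + g x)"
proof (induction k arbitrary: f g)
  case (Suc k)
  show ?case
    by (rule Ck_SucI[OF has_derivative_add[OF Ck_has_derivative Ck_has_derivative]])
      (use Suc in auto)
qed (auto intro: continuous_intros)

lemma Ck_bounded_linear: "bounded_linear L \<Longrightarrow> Ck k f \<Longrightarrow> Ck k (\<lambda>x. L (f x))"
proof (induction k arbitrary: f)
  case 0
  then show ?case by (auto intro: bounded_linear.continuous_on)
next
  case (Suc k)
  show ?case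
    by (rule Ck_SucI[OF bounded_linear.has_derivative[OF Suc.prems(1) Ck_has_derivative]])
      (use Suc in auto)
qed

lemma Ck_mult:
  fixes f g :: "'a::euclidean_space \<Rightarrow> real"
  shows "Ck k f \<Longrightarrow> Ck k g \<Longrightarrow> Ck k (\<lambda>x. f x * g x)"
proof (induction k arbitrary: f g)
  case (Suc k)
  show ?case
  proof (rule Ck_SucI[OF has_derivative_mult[OF Ck_has_derivative Ck_has_derivative]])
    show "Ck (Suc k) f" "Ck (Suc k) g" by fact+
    show "Ck k (\<lambda>x. f x * frechet_derivative g (at x) v + frechet_derivative f (at x) v * g x)" for v
      using Suc Ck_SucD by (intro Ck_add Suc.IH) auto
  qed
qed (auto intro: continuous_intros)

lemma Ck_compose:
  fixes G :: "real \<Rightarrow> real" and f :: "'a::euclidean_space \<Rightarrow> real"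
  shows "Ck k G \<Longrightarrow> Ck k f \<Longrightarrow> Ck k (\<lambda>x. G (f x))"
proof (induction k arbitrary: G f)
  case 0
  then show ?case by (auto intro: continuous_on_compose2)
next
  case (Suc k)
  let ?G = "\<lambda>y. frechet_derivative G (at y) 1"
  have G: "frechet_derivative G (at y) v = ?G y * v" for y v
    using linear_cmul[OF linear_frechet_derivative[of G "at y"], of v 1] Suc.prems by simp
  have *: "((\<lambda>x. G (f x)) has_derivative (\<lambda>v. ?G (f x) * frechet_derivative f (at x) v)) (at x)" for x
    using has_derivative_compose[OF Ck_has_derivative[OF Suc.prems(2), of x] Ck_has_derivative[OF Suc.prems(1), of "f x"]]
    by (subst (asm) G)
  show ?case
  proof (rule Ck_SucI[OF *])
    fix v
    have "Ck k ?G" "Ck k (\<lambda>x. frechet_derivative f (at x) v)"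
      using Suc.prems by simp_all
    then show "Ck k (\<lambda>x. ?G (f x) * frechet_derivative f (at x) v)"
      by (intro Ck_mult Suc.IH[OF _ Ck_SucD[OF Suc.prems(2)]])
  qed
qed

lemma Ck_translate: "Ck k f \<Longrightarrow> Ck k (\<lambda>x. f (x + c))"
proof (induction k arbitrary: f)
  case 0
  then show ?case by (auto intro!: continuous_on_compose2[of UNIV f] continuous_intros)
next
  case (Suc k)
  have *: "((\<lambda>x. f (x + c)) has_derivative frechet_derivative f (at (x + c))) (at x)" for x
  proof (rule has_derivative_compose[where f="\<lambda>x. x + c" and f'="\<lambda>v. v"])
    show "((\<lambda>x. x + c) has_derivative (\<lambda>v. v)) (at x)"
      by (auto intro!: derivative_eq_intros)
  qed (rule Ck_has_derivative[OF Suc.prems])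
  show ?case
    by (rule Ck_SucI[OF *]) (use Suc in auto)
qed

lemma Ck_norm_squared: "Ck k (\<lambda>x::'a::euclidean_space. x \<bullet> x)"
proof (cases k)
  case (Suc j)
  have *: "((\<lambda>x::'a. x \<bullet> x) has_derivative (\<lambda>v. 2 * (v \<bullet> x))) (at x)" for x
    by (auto intro!: derivative_eq_intros simp: inner_commute)
  have id: "Ck j (\<lambda>x::'a. x)" for j
  proof (cases j)
    case (Suc i)
    show ?thesis unfolding Suc by (rule Ck_SucI[OF has_derivative_ident Ck_const])
  qed (auto intro: continuous_intros)
  have "bounded_linear (\<lambda>x. 2 * (v \<bullet> x))" for v :: 'a
    by (intro bounded_linear_const_mult bounded_linear_inner_right)
  then have "Ck j (\<lambda>x::'a. 2 * (v \<bullet> x))" for v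
    by (rule Ck_bounded_linear[OF _ id])
  then show ?thesis unfolding Suc by (rule Ck_SucI[OF *])
qed (auto intro: continuous_intros)

section \<open>Smooth functions on the line that are flat at the origin\<close>

lemma tendsto_poly_div_exp: "((\<lambda>u. poly p u / exp u) \<longlongrightarrow> (0::real)) at_top"
proof -
  have "((\<lambda>u. \<Sum>i\<le>degree p. coeff p i * (u ^ i / exp u)) \<longlongrightarrow> (\<Sum>i\<le>degree p. coeff p i * 0)) at_top"
    by (intro tendsto_intros tendsto_power_div_exp_0)
  then show ?thesis by (simp add: poly_altdef sum_divide_distrib)
qed

text \<open>For \<open>p = 1\<close> this is the classical function \<open>exp (- 1 / x)\<close>, extended by 0. Allowing a polynomial
factor in \<open>1 / x\<close> makes the family closed under differentiation, so that smoothness of all its members is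
a single induction.\<close>

definition flat :: "real poly \<Rightarrow> real \<Rightarrow> real" where
  "flat p x = (if x > 0 then poly p (1 / x) * exp (- (1 / x)) else 0)"

abbreviation flat_deriv :: "real poly \<Rightarrow> real poly" where
  "flat_deriv p \<equiv> [:0, 0, 1:] * (p - pderiv p)"

text \<open>Only the origin needs an argument: with \<open>u = 1 / h\<close> the right difference quotient is
\<open>u p(u) / exp u\<close>, which tends to 0.\<close>

lemma DERIV_flat: "(flat p has_field_derivative flat (flat_deriv p) x) (at x)"
proof -
  consider "x > 0" | "x < 0" | "x = 0" by linarith
  then show ?thesis
  proof cases
    case 1
    have "((\<lambda>x. poly p (1 / x) * exp (- (1 / x))) has_field_derivative flat (flat_deriv p) x) (at x)"
      using 1 by (auto intro!: derivative_eq_intros simp: flat_def field_simps power2_eq_square)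
    then show ?thesis
      by (rule DERIV_cong_ev[THEN iffD1, rotated -1, OF _ refl _ refl])
        (use 1 in \<open>auto simp: flat_def eventually_nhds intro!: exI[of _ "{0<..}"]\<close>)
  next
    case 2
    have "((\<lambda>x. 0) has_field_derivative flat (flat_deriv p) x) (at x)"
      using 2 by (auto simp: flat_def)
    then show ?thesis
      by (rule DERIV_cong_ev[THEN iffD1, rotated -1, OF _ refl _ refl])
        (use 2 in \<open>auto simp: flat_def eventually_nhds intro!: exI[of _ "{..<0}"]\<close>)
  next
    case 3
    have "((\<lambda>h. (flat p (0 + h) - flat p 0) / h) \<longlongrightarrow> 0) (at (0::real))"
    proof (rule filterlim_split_at)
      show "((\<lambda>h. (flat p (0 + h) - flat p 0) / h) \<longlongrightarrow> 0) (at_left (0::real))"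
        by (rule tendsto_eventually) (auto simp: eventually_at flat_def intro!: exI[of _ 1])
      have "((\<lambda>u. poly ([:0, 1:] * p) u / exp u) \<longlongrightarrow> (0::real)) at_top"
        by (rule tendsto_poly_div_exp)
      then have "((\<lambda>u. (flat p (0 + inverse u) - flat p 0) / inverse u) \<longlongrightarrow> (0::real)) at_top"
        by (rule Lim_transform_eventually)
          (auto simp: eventually_at_top_dense flat_def exp_minus field_simps intro!: exI[of _ 0])
      then show "((\<lambda>h. (flat p (0 + h) - flat p 0) / h) \<longlongrightarrow> 0) (at_right (0::real))"
        by (simp add: filterlim_at_right_to_top)
    qed
    then show ?thesis unfolding 3 by (simp add: DERIV_def flat_def)
  qed
qed

lemma Ck_flat: "Ck k (flat p)"
proof (induction k arbitrary: p)
  case 0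
  show ?case
    using DERIV_isCont[OF DERIV_flat] by (simp add: continuous_at_imp_continuous_on)
next
  case (Suc k)
  have *: "(flat p has_derivative (\<lambda>v. v * flat (flat_deriv p) x)) (at x)" for x
    by (rule has_derivative_eq_rhs[OF DERIV_flat[unfolded has_field_derivative_def]])
      (simp add: fun_eq_iff mult.commute)
  show ?case by (rule Ck_SucI[OF *]) (intro Ck_mult Ck_const Suc)
qed

section \<open>Gradients and bounded supports\<close>

lemma Cc_infty_iff: "\<Phi> \<in> Cc_infty \<longleftrightarrow> (\<forall>k. Ck k \<Phi>) \<and> bounded {x. \<Phi> x \<noteq> 0}"
  by (simp add: Cc_infty_def)

definition gradient :: "('a::euclidean_space \<Rightarrow> real) \<Rightarrow> 'a \<Rightarrow> 'a" where
  "gradient f x = (\<Sum>b\<in>Basis. frechet_derivative f (at x) b *\<^sub>R b)"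

lemma gradient_inner:
  assumes "Ck (Suc k) f"
  shows "frechet_derivative f (at x) v = gradient f x \<bullet> v"
proof -
  interpret linear "frechet_derivative f (at x)"
    using assms by (intro linear_frechet_derivative) simp
  have "frechet_derivative f (at x) v = frechet_derivative f (at x) (\<Sum>b\<in>Basis. (v \<bullet> b) *\<^sub>R b)"
    by (simp add: euclidean_representation)
  also have "\<dots> = (\<Sum>b\<in>Basis. (v \<bullet> b) * frechet_derivative f (at x) b)"
    by (simp add: sum scale del: euclidean_representation)
  finally show ?thesis
    by (simp add: gradient_def inner_sum_left inner_commute[of v] mult.commute)
qed

lemma continuous_gradient: "Ck (Suc k) f \<Longrightarrow> continuous_on UNIV (gradient f)"
  unfolding gradient_def by (intro continuous_intros) (auto intro: Ck_continuous)

lemma frechet_derivative_eq_0: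
  assumes "x \<notin> closure {x. f x \<noteq> 0}"
  shows "frechet_derivative f (at x) = (\<lambda>v. 0)"
proof -
  have "(f has_derivative (\<lambda>v. 0)) (at x)"
  proof (rule has_derivative_transform_within_open[where f="\<lambda>x. 0"])
    show "x \<in> - closure {x. f x \<noteq> 0}" using assms by simp
    show "0 = f y" if "y \<in> - closure {x. f x \<noteq> 0}" for y
      using that closure_subset[of "{x. f x \<noteq> 0}"] by auto
  qed (simp_all add: open_Compl)
  then show ?thesis by (rule frechet_derivative_at[symmetric])
qed

lemma zero_outside_support: "x \<notin> closure {x. f x \<noteq> 0} \<Longrightarrow> f x = 0"
  using closure_subset[of "{x. f x \<noteq> 0}"] by auto

lemma bounded_support_derivative:
  assumes "bounded {x. f x \<noteq> 0}"
  shows "bounded {x. frechet_derivative f (at x) v \<noteq> 0}"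
proof (rule bounded_subset[OF bounded_closure[OF assms]], safe)
  fix x assume "frechet_derivative f (at x) v \<noteq> 0"
  then show "x \<in> closure {x. f x \<noteq> 0}"
    by (metis frechet_derivative_eq_0)
qed

lemma Cc_infty_derivative:
  "f \<in> Cc_infty \<Longrightarrow> (\<lambda>x. frechet_derivative f (at x) v) \<in> Cc_infty"
  unfolding Cc_infty_iff
  by (auto simp only: intro!: bounded_support_derivative) (metis Ck.simps(2))

lemma bounded_support_gradient:
  assumes "bounded {x. f x \<noteq> 0}"
  shows "bounded {x. gradient f x \<noteq> 0}"
proof (rule bounded_subset[OF bounded_closure[OF assms]], safe)
  fix x assume "gradient f x \<noteq> 0"
  then show "x \<in> closure {x. f x \<noteq> 0}"
    by (rule contrapos_np) (simp add: gradient_def frechet_derivative_eq_0)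
qed

lemma bounded_support_cball:
  fixes S :: "'a::real_normed_vector set"
  assumes "bounded S" obtains r where "S \<subseteq> cball 0 r"
  using assms unfolding bounded_iff by (metis mem_cball_0 subsetI)

lemma bounded_support_shift:
  fixes x :: "'a::euclidean_space"
  assumes "bounded {y. f y \<noteq> 0}"
  shows "bounded {y. f (y - x) \<noteq> 0}"
proof -
  have "{y. f (y - x) \<noteq> 0} = (+) x ` {y. f y \<noteq> 0}"
  proof (intro set_eqI iffI)
    fix y assume "y \<in> {y. f (y - x) \<noteq> 0}"
    then show "y \<in> (+) x ` {y. f y \<noteq> 0}"
      by (intro image_eqI[of _ _ "y - x"]) simp_all
  qed auto
  then show ?thesis using bounded_translation[OF assms] by simp
qed

lemma bounded_range_bounded_support:
  fixes f :: "'a::euclidean_space \<Rightarrow> 'b::real_normed_vector"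
  assumes "continuous_on UNIV f" "bounded {x. f x \<noteq> 0}"
  obtains M where "M > 0" "\<And>x. norm (f x) \<le> M"
proof -
  have "compact (f ` closure {x. f x \<noteq> 0})"
    using assms(2) by (intro compact_continuous_image continuous_on_subset[OF assms(1)]) auto
  then have "bounded (f ` closure {x. f x \<noteq> 0})" by (rule compact_imp_bounded)
  then obtain M where M: "M > 0" "\<forall>y \<in> f ` closure {x. f x \<noteq> 0}. norm y \<le> M"
    unfolding bounded_pos by blast
  have "norm (f x) \<le> M" for x
  proof (cases "f x = 0")
    case False
    then have "x \<in> closure {x. f x \<noteq> 0}" using closure_subset[of "{x. f x \<noteq> 0}"] by blast
    then show ?thesis using M(2) by blast
  qed (use M(1) in simp)
  then show ?thesis using that M(1) by blast
qed

lemma uniformly_continuous_bounded_support: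
  fixes f :: "'a::euclidean_space \<Rightarrow> 'b::real_normed_vector"
  assumes "continuous_on UNIV f" "bounded {x. f x \<noteq> 0}"
  shows "uniformly_continuous_on UNIV f"
  unfolding uniformly_continuous_on_def
proof safe
  fix e :: real assume "e > 0"
  obtain r where r: "{x. f x \<noteq> 0} \<subseteq> cball 0 r"
    by (rule bounded_support_cball[OF assms(2)])
  have "uniformly_continuous_on (cball 0 (r + 1)) f"
    by (intro compact_uniformly_continuous continuous_on_subset[OF assms(1)]) auto
  then obtain d where d: "d > 0"
    "\<And>x y. x \<in> cball 0 (r + 1) \<Longrightarrow> y \<in> cball 0 (r + 1) \<Longrightarrow> dist y x < d \<Longrightarrow> dist (f y) (f x) < e"
    by (rule uniformly_continuous_onE[OF _ \<open>e > 0\<close>]) (rule that, assumption, simp)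
  have "dist (f y) (f x) < e" if "dist y x < min d 1" for x y
  proof (cases "norm x \<le> r + 1 \<and> norm y \<le> r + 1")
    case True
    then show ?thesis using d that by auto
  next
    case False
    have "\<bar>norm x - norm y\<bar> < 1"
      using that norm_triangle_ineq3[of y x] by (auto simp: dist_norm)
    with False have "x \<notin> cball 0 r" "y \<notin> cball 0 r"
      by auto
    then show ?thesis using r \<open>e > 0\<close> by (metis (mono_tags) dist_self mem_Collect_eq subsetD)
  qed
  then show "\<exists>d>0. \<forall>x\<in>UNIV. \<forall>x'\<in>UNIV. dist x' x < d \<longrightarrow> dist (f x') (f x) < e"
    using d(1) by (intro exI[of _ "min d 1"]) auto
qed

text \<open>The gradient is continuous with bounded support, hence uniformly continuous, and the mean value
inequality turns this into a first order expansion that is uniform in the base point. It is the tool for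
differentiating under the integral sign.\<close>

lemma uniform_differentiability:
  fixes f :: "'a::euclidean_space \<Rightarrow> real"
  assumes f: "Ck (Suc 0) f" "bounded {x. f x \<noteq> 0}" and e: "e > 0"
  obtains d where "d > 0"
    "\<And>x v. norm v < d \<Longrightarrow> \<bar>f (x + v) - f x - frechet_derivative f (at x) v\<bar> \<le> e * norm v"
proof -
  have "uniformly_continuous_on UNIV (gradient f)"
    using f continuous_gradient bounded_support_gradient
    by (intro uniformly_continuous_bounded_support) blast+
  then obtain d where d: "d > 0" "\<And>x y. x \<in> UNIV \<Longrightarrow> y \<in> UNIV \<Longrightarrow> dist y x < d \<Longrightarrow>
      dist (gradient f y) (gradient f x) < e"
    by (rule uniformly_continuous_onE[OF _ e]) (rule that, assumption, simp)
  have "\<bar>f (x + v) - f x - frechet_derivative f (at x) v\<bar> \<le> e * norm v" if v: "norm v < d" for x v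
  proof -
    have "norm (f (x + v) - f x - frechet_derivative f (at x) (x + v - x)) \<le> norm (x + v - x) * e"
    proof (rule differentiable_bound_linearization[of x "x + v" "ball x d" f "\<lambda>y. frechet_derivative f (at y)"])
      show "x + t *\<^sub>R (x + v - x) \<in> ball x d" if "t \<in> {0..1}" for t
      proof -
        have "t * norm v \<le> 1 * norm v" using that by (intro mult_right_mono) auto
        then show ?thesis using that v by (simp add: dist_norm)
      qed
      show "(f has_derivative frechet_derivative f (at y)) (at y within ball x d)" for y
        using Ck_has_derivative[OF f(1)] has_derivative_at_withinI by blast
      show "onorm (frechet_derivative f (at y) - frechet_derivative f (at x)) \<le> e" if "y \<in> ball x d" for y
      proof (rule onorm_le)
        fix w
        have "norm ((frechet_derivative f (at y) - frechet_derivative f (at x)) w)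
            = norm ((gradient f y - gradient f x) \<bullet> w)"
          by (simp add: gradient_inner[OF f(1)] inner_diff_left)
        also have "\<dots> \<le> norm (gradient f y - gradient f x) * norm w"
          using Cauchy_Schwarz_ineq2 by (metis real_norm_def)
        also have "\<dots> \<le> e * norm w"
          using d(2)[OF UNIV_I UNIV_I, of y x] that by (intro mult_right_mono) (auto simp: dist_norm norm_minus_commute)
        finally show "norm ((frechet_derivative f (at y) - frechet_derivative f (at x)) w) \<le> e * norm w" .
      qed
    qed (use d in auto)
    then show ?thesis by (simp add: mult.commute)
  qed
  then show ?thesis using d(1) that by blast
qed

section \<open>Locally integrable functions and correlation with a smooth kernel\<close>

text \<open>Borel measurability is part of the notion because the functions appear in integrals over product
spaces: for a Lebesgue measurable \<open>f\<close>, the map \<open>(x, z) \<mapsto> f (x + z)\<close> can fail to be measurable for the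
product of the two Lebesgue sigma-algebras.\<close>

definition L1_loc :: "('a::euclidean_space \<Rightarrow> 'b::euclidean_space) \<Rightarrow> bool" where
  "L1_loc f \<longleftrightarrow> f \<in> borel_measurable borel \<and> (\<forall>r. set_integrable lborel (cball 0 r) f)"

lemma L1_loc_bounded:
  fixes f :: "'a::euclidean_space \<Rightarrow> 'b::euclidean_space"
  assumes [measurable]: "f \<in> borel_measurable borel" and M: "\<And>x. norm (f x) \<le> M"
  shows "L1_loc f"
  unfolding L1_loc_def set_integrable_def
proof safe
  fix r :: real
  have "integrable lborel (\<lambda>x. indicator (cball 0 r) x * M)"
    by (intro integrable_mult_left integrable_real_indicator) (use emeasure_bounded_finite[OF bounded_cball, of 0 r] in auto)
  then show "integrable lborel (\<lambda>x. indicator (cball 0 r) x *\<^sub>R f x)"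
  proof (rule Bochner_Integration.integrable_bound)
    show "AE x in lborel. norm (indicator (cball 0 r) x *\<^sub>R f x) \<le> norm (indicator (cball 0 r) x * M)"
      using M by (intro AE_I2) (auto simp: indicator_def intro: order_trans[OF _ abs_ge_self])
    show "(\<lambda>x. indicator (cball 0 r) x *\<^sub>R f x) \<in> borel_measurable lborel"
      by (intro borel_measurable_scaleR borel_measurable_indicator) (use assms(1) in auto)
  qed
qed fact

lemma L1_loc_continuous:
  fixes f :: "'a::euclidean_space \<Rightarrow> 'b::euclidean_space"
  assumes "continuous_on UNIV f"
  shows "L1_loc f"
  unfolding L1_loc_def
  using assms by (auto intro!: borel_integrable_compact simp: set_integrable_def borel_measurable_continuous_onI
      intro: continuous_on_subset)

lemma integrable_scaleR_L1_loc:
  assumes f: "L1_loc f" and [measurable]: "g \<in> borel_measurable borel"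
    and M: "\<And>x. \<bar>g x\<bar> \<le> M" and r: "bounded {x. g x \<noteq> 0}"
  shows "integrable lborel (\<lambda>x. g x *\<^sub>R f x)"
proof -
  obtain r where r: "{x. g x \<noteq> 0} \<subseteq> cball 0 r"
    by (rule bounded_support_cball[OF r])
  have "integrable lborel (\<lambda>x. M * norm (indicator (cball 0 r) x *\<^sub>R f x))"
    using f by (intro integrable_mult_right integrable_norm) (auto simp: L1_loc_def set_integrable_def)
  then show ?thesis
  proof (rule Bochner_Integration.integrable_bound)
    show "(\<lambda>x. g x *\<^sub>R f x) \<in> borel_measurable lborel"
      using f by (intro borel_measurable_scaleR) (auto simp: L1_loc_def)
    have "\<bar>g x\<bar> * norm (f x) \<le> \<bar>M\<bar> * norm (indicator (cball 0 r) x *\<^sub>R f x)" for x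
    proof (cases "g x = 0")
      case False
      then have "x \<in> cball 0 r" using r by auto
      then show ?thesis using M[of x] by (auto intro: mult_right_mono)
    qed auto
    then show "AE x in lborel. norm (g x *\<^sub>R f x) \<le> norm (M * norm (indicator (cball 0 r) x *\<^sub>R f x))"
      by (simp add: abs_mult)
  qed
qed

lemma integrable_kernel_L1_loc:
  assumes f: "L1_loc f" and k: "continuous_on UNIV k" "bounded {x. k x \<noteq> (0::real)}"
  shows "integrable lborel (\<lambda>y. k (y - x) *\<^sub>R f y)"
proof -
  obtain M where "M > 0" and M: "\<And>x. norm (k x) \<le> M"
    by (rule bounded_range_bounded_support[OF k]) (rule that, assumption, simp)
  have "k \<in> borel_measurable borel"
    using k by (simp add: borel_measurable_continuous_onI)
  then show ?thesis
    using M k(2) bounded_support_shift[of k x]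
    by (intro integrable_scaleR_L1_loc[OF f, of _ M]) auto
qed

lemma integrable_continuous_bounded_support:
  fixes f :: "'a::euclidean_space \<Rightarrow> real"
  assumes "continuous_on UNIV f" "bounded {x. f x \<noteq> 0}"
  shows "integrable lborel f"
  using integrable_kernel_L1_loc[OF L1_loc_continuous[of "\<lambda>x. 1::real"] assms, of 0] by simp

text \<open>For an even kernel this is convolution. The form \<open>k (y - x)\<close> is chosen because exchanging the roles of
the two functions then only flips the sign of the argument of \<open>k\<close>, and because it also covers translates
\<open>\<integral> g (y - s z) f y\<close> of a test function \<open>g\<close>.\<close>

definition correlation :: "('a::euclidean_space \<Rightarrow> real) \<Rightarrow> ('a \<Rightarrow> 'b::euclidean_space) \<Rightarrow> 'a \<Rightarrow> 'b" where
  "correlation k f x = (\<integral>y. k (y - x) *\<^sub>R f y \<partial>lborel)"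

text \<open>The uniform first order expansion of \<open>k\<close> is integrated against \<open>f\<close>; for increments of norm less than 1 the
remainder is supported in a fixed ball, on which \<open>f\<close> is integrable.\<close>

lemma correlation_has_derivative:
  assumes f: "L1_loc f" and k: "Ck (Suc 0) k" "bounded {x. k x \<noteq> 0}"
  shows "(correlation k f has_derivative
          (\<lambda>v. correlation (\<lambda>z. frechet_derivative k (at z) (- v)) f x)) (at x)"
proof -
  let ?D = "\<lambda>v. correlation (\<lambda>z. frechet_derivative k (at z) (- v)) f x"
  have D: "linear (frechet_derivative k (at z))" for z
    using k(1) by (intro linear_frechet_derivative) simp
  have int: "integrable lborel (\<lambda>y. k (y - x) *\<^sub>R f y)" for x
    by (rule integrable_kernel_L1_loc[OF f Ck_continuous[OF k(1)] k(2)])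
  have intD: "integrable lborel (\<lambda>y. frechet_derivative k (at (y - x)) v *\<^sub>R f y)" for v x
    using k by (intro integrable_kernel_L1_loc[OF f] bounded_support_derivative) auto
  have "linear ?D"
  proof
    fix v w :: 'a and c :: real
    show "?D (v + w) = ?D v + ?D w"
      unfolding correlation_def using intD
      by (simp add: linear_add[OF D] linear_diff[OF D] linear_neg[OF D] scaleR_add_left scaleR_diff_left
          flip: Bochner_Integration.integral_add Bochner_Integration.integral_minus)
    show "?D (c *\<^sub>R v) = c *\<^sub>R ?D v"
      unfolding correlation_def using intD
      by (simp add: linear_cmul[OF D] linear_neg[OF D] flip: integral_scaleR_right scaleR_scaleR)
  qed
  then have bl: "bounded_linear ?D" by (simp add: linear_conv_bounded_linear)
  obtain r where r: "closure {x. k x \<noteq> 0} \<subseteq> cball 0 r"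
    by (rule bounded_support_cball[OF bounded_closure[OF k(2)]])
  define C where "C = cball (0::'a) (r + norm x + 1)"
  have intC: "integrable lborel (\<lambda>y. indicator C y * norm (f y))"
    using f integrable_norm[of lborel "\<lambda>y. indicator C y *\<^sub>R f y"]
    by (simp add: L1_loc_def C_def set_integrable_def)
  define I where "I = (\<integral>y. indicator C y * norm (f y) \<partial>lborel)"
  have "I \<ge> 0" unfolding I_def by (intro integral_nonneg_AE) auto
  have "\<exists>d>0. \<forall>y. norm (y - x) < d \<longrightarrow>
      norm (correlation k f y - correlation k f x - ?D (y - x)) \<le> e * norm (y - x)" if "e > 0" for e
  proof -
    have "e / (I + 1) > 0" using \<open>I \<ge> 0\<close> that by simp
    then obtain d where d: "d > 0" "\<And>z v. norm v < d \<Longrightarrow>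
        \<bar>k (z + v) - k z - frechet_derivative k (at z) v\<bar> \<le> e / (I + 1) * norm v"
      using uniform_differentiability[OF k] by blast
    have "norm (correlation k f x' - correlation k f x - ?D (x' - x)) \<le> e * norm (x' - x)"
      if x': "norm (x' - x) < min d 1" for x'
    proof -
      let ?v = "x - x'"
      let ?R = "\<lambda>y. k (y - x') - k (y - x) - frechet_derivative k (at (y - x)) ?v"
      \<comment> \<open>both \<open>y - x\<close> and \<open>y - x'\<close> lie outside the support of \<open>k\<close>\<close>
      have R0: "?R y = 0" if "y \<notin> C" for y
      proof -
        have "norm y > r + norm x + 1" using that by (simp add: C_def)
        then have "norm (y - x) > r" "norm (y - x') > r"
          using norm_triangle_ineq2[of y x] norm_triangle_ineq2[of y x']
            norm_triangle_ineq2[of x' x] x' by auto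
        then have *: "y - x \<notin> closure {x. k x \<noteq> 0}" "y - x' \<notin> closure {x. k x \<noteq> 0}"
          using r by auto
        have "k (y - x) = 0" "k (y - x') = 0"
          using zero_outside_support[OF *(1)] zero_outside_support[OF *(2)] by simp_all
        then show ?thesis using frechet_derivative_eq_0[OF *(1)] by simp
      qed
      have R: "\<bar>?R y\<bar> \<le> e / (I + 1) * norm ?v * indicator C y" for y
        using R0[of y] d(2)[of ?v "y - x"] x'
        by (cases "y \<in> C") (auto simp: norm_minus_commute)
      have "correlation k f x' - correlation k f x - ?D (x' - x) = (\<integral>y. ?R y *\<^sub>R f y \<partial>lborel)"
        unfolding correlation_def using int intD
        by (simp add: scaleR_diff_left)
      also have "norm \<dots> \<le> (\<integral>y. (e / (I + 1) * norm ?v) * (indicator C y * norm (f y)) \<partial>lborel)"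
      proof (rule Bochner_Integration.integral_norm_bound_integral)
        show "integrable lborel (\<lambda>y. ?R y *\<^sub>R f y)"
          using int intD by (simp add: scaleR_diff_left)
        show "integrable lborel (\<lambda>y. (e / (I + 1) * norm ?v) * (indicator C y * norm (f y)))"
          by (intro integrable_mult_right intC)
        show "norm (?R y *\<^sub>R f y) \<le> (e / (I + 1) * norm ?v) * (indicator C y * norm (f y))" for y
          using mult_right_mono[OF R, of "norm (f y)" y] by (simp add: mult.assoc)
      qed
      also have "\<dots> = e * norm (x' - x) * (I / (I + 1))"
        by (simp add: I_def[symmetric] norm_minus_commute)
      also have "\<dots> \<le> e * norm (x' - x) * 1"
        using \<open>I \<ge> 0\<close> \<open>e > 0\<close> by (intro mult_left_mono) auto
      finally show ?thesis by simp
    qed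
    then show ?thesis using d(1) by (intro exI[of _ "min d 1"]) auto
  qed
  with bl show ?thesis unfolding has_derivative_at_alt by blast
qed

lemma frechet_derivative_correlation:
  assumes "L1_loc f" and "Ck (Suc 0) k" "bounded {x. k x \<noteq> 0}"
  shows "frechet_derivative (correlation k f) (at x) v =
    correlation (\<lambda>z. frechet_derivative k (at z) (- v)) f x"
  using frechet_derivative_at[OF correlation_has_derivative[OF assms], of x] by metis

text \<open>Each directional derivative of a correlation is again a correlation with a smooth kernel of bounded
support, so the regularity comes entirely from the kernel.\<close>

lemma Ck_correlation:
  assumes "L1_loc f" "k \<in> Cc_infty"
  shows "Ck n (correlation k f)"
  using assms(2)
proof (induction n arbitrary: k)
  case 0
  have "correlation k f differentiable (at x)" for x
    using correlation_has_derivative[OF assms(1), of k] 0 unfolding differentiable_def Cc_infty_iff by blast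
  then show ?case
    by (simp add: continuous_at_imp_continuous_on differentiable_imp_continuous_within)
next
  case (Suc n)
  show ?case
  proof (rule Ck_SucI)
    show "(correlation k f has_derivative
          (\<lambda>v. correlation (\<lambda>z. frechet_derivative k (at z) (- v)) f x)) (at x)" for x
      using correlation_has_derivative[OF assms(1), of k] Suc.prems unfolding Cc_infty_iff by blast
  qed (intro Suc.IH Cc_infty_derivative Suc.prems)
qed

lemma correlation_Cc_infty:
  assumes "L1_loc f" "k \<in> Cc_infty" "bounded {x. f x \<noteq> 0}"
  shows "correlation k f \<in> Cc_infty"
proof -
  obtain r where r: "{x. k x \<noteq> 0} \<subseteq> cball 0 r"
    using assms(2) bounded_support_cball unfolding Cc_infty_iff by metis
  obtain s where s: "{x. f x \<noteq> 0} \<subseteq> cball 0 s"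
    by (rule bounded_support_cball[OF assms(3)])
  have "correlation k f x = 0" if "x \<notin> cball 0 (r + s)" for x
  proof -
    have "k (y - x) *\<^sub>R f y = 0" for y
    proof (rule ccontr)
      assume "k (y - x) *\<^sub>R f y \<noteq> 0"
      then have "y - x \<in> cball 0 r" "y \<in> cball 0 s" using r s by auto
      then show False using that norm_triangle_ineq4[of y "y - x"] by auto
    qed
    then show ?thesis by (simp only: correlation_def Bochner_Integration.integral_zero)
  qed
  then have "bounded {x. correlation k f x \<noteq> 0}"
    by (intro bounded_subset[OF bounded_cball[of 0 "r + s"]]) blast
  then show ?thesis using Ck_correlation[OF assms(1,2)] by (simp add: Cc_infty_iff)
qed

text \<open>Fubini's theorem. The supports of \<open>k\<close> and \<open>g\<close> confine \<open>y\<close> to a ball, where \<open>f\<close> is integrable.\<close>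

lemma integral_correlation_swap:
  fixes f g :: "'a::euclidean_space \<Rightarrow> real"
  assumes f: "L1_loc f" and g: "L1_loc g" "bounded {x. g x \<noteq> 0}"
    and k: "continuous_on UNIV k" "bounded {x. k x \<noteq> (0::real)}"
  shows "(\<integral>x. correlation k f x * g x \<partial>lborel) = (\<integral>y. f y * (\<integral>x. k (y - x) * g x \<partial>lborel) \<partial>lborel)"
proof -
  obtain r where r: "{x. k x \<noteq> 0} \<subseteq> cball 0 r" by (rule bounded_support_cball[OF k(2)])
  obtain s where s: "{x. g x \<noteq> 0} \<subseteq> cball 0 s" by (rule bounded_support_cball[OF g(2)])
  obtain M where "M > 0" and M: "\<And>x. norm (k x) \<le> M"
    by (rule bounded_range_bounded_support[OF k]) (rule that, assumption, simp)
  have [measurable]: "k \<in> borel_measurable borel"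
    using k(1) by (rule borel_measurable_continuous_onI)
  have [measurable]: "f \<in> borel_measurable borel" "g \<in> borel_measurable borel"
    using f g(1) by (auto simp: L1_loc_def)
  let ?Q = "\<lambda>x y. k (y - x) * f y * g x"
  define N where "N = (\<integral>y. indicator (cball 0 (r + s)) y * \<bar>f y\<bar> \<partial>lborel)"
  have intN: "integrable lborel (\<lambda>y. indicator (cball 0 (r + s)) y * \<bar>f y\<bar>)"
    using f integrable_norm[of lborel "\<lambda>y. indicator (cball 0 (r + s)) y *\<^sub>R f y"]
    by (simp add: L1_loc_def set_integrable_def abs_mult)
  have intg: "integrable lborel g"
  proof -
    have eq: "(\<lambda>x. indicator (cball 0 s) x * g x) = g"
      using s by (auto simp: indicator_def fun_eq_iff)
    have "integrable lborel (\<lambda>x. indicator (cball 0 s) x * g x)"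
      using g(1) by (simp add: L1_loc_def set_integrable_def)
    then show ?thesis by (simp only: eq)
  qed
  have int: "integrable lborel (\<lambda>y. k (y - x) * f y)" for x
    using integrable_kernel_L1_loc[OF f k] by simp
  have bound: "norm (?Q x y) \<le> \<bar>g x\<bar> * (M * (indicator (cball 0 (r + s)) y * \<bar>f y\<bar>))" for x y
  proof (cases "g x = 0 \<or> k (y - x) = 0")
    case False
    then have "x \<in> cball 0 s" "y - x \<in> cball 0 r" using r s by auto
    then have "y \<in> cball 0 (r + s)"
      using norm_triangle_ineq[of "y - x" x] by simp
    then have "norm (?Q x y) = \<bar>g x\<bar> * (\<bar>k (y - x)\<bar> * (indicator (cball 0 (r + s)) y * \<bar>f y\<bar>))"
      by (simp add: abs_mult)
    also have "\<dots> \<le> \<bar>g x\<bar> * (M * (indicator (cball 0 (r + s)) y * \<bar>f y\<bar>))"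
      using M[of "y - x"] by (intro mult_left_mono mult_right_mono) auto
    finally show ?thesis .
  qed (use \<open>M > 0\<close> in auto)
  have "integrable (lborel \<Otimes>\<^sub>M lborel) (\<lambda>(x, y). ?Q x y)"
  proof (rule lborel_pair.Fubini_integrable)
    have le: "(\<integral>y. norm (?Q x y) \<partial>lborel) \<le> \<bar>g x\<bar> * (M * N)" for x
    proof -
      have "(\<integral>y. norm (?Q x y) \<partial>lborel) \<le> (\<integral>y. \<bar>g x\<bar> * (M * (indicator (cball 0 (r + s)) y * \<bar>f y\<bar>)) \<partial>lborel)"
        using int intN bound by (intro Bochner_Integration.integral_mono) auto
      then show ?thesis by (simp add: N_def)
    qed
    show "integrable lborel (\<lambda>x. \<integral>y. norm (case (x, y) of (x, y) \<Rightarrow> ?Q x y) \<partial>lborel)"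
    proof (rule Bochner_Integration.integrable_bound[of lborel "\<lambda>x. \<bar>g x\<bar> * (M * N)"])
      show "integrable lborel (\<lambda>x. \<bar>g x\<bar> * (M * N))"
        by (intro integrable_mult_left integrable_abs intg)
      show "AE x in lborel. norm (\<integral>y. norm (case (x, y) of (x, y) \<Rightarrow> ?Q x y) \<partial>lborel) \<le> norm (\<bar>g x\<bar> * (M * N))"
      proof (rule AE_I2)
        fix x
        have "0 \<le> (\<integral>y. norm (?Q x y) \<partial>lborel)" by (rule integral_nonneg_AE) simp
        then show "norm (\<integral>y. norm (case (x, y) of (x, y) \<Rightarrow> ?Q x y) \<partial>lborel) \<le> norm (\<bar>g x\<bar> * (M * N))"
          using le[of x] by (simp only: prod.case real_norm_def abs_of_nonneg)
      qed
    qed measurable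
    show "AE x in lborel. integrable lborel (\<lambda>y. case (x, y) of (x, y) \<Rightarrow> ?Q x y)"
      using int by (intro AE_I2) simp
  qed measurable
  from lborel_pair.Fubini_integral[OF this]
  have "(\<integral>x. \<integral>y. ?Q x y \<partial>lborel \<partial>lborel) = (\<integral>y. \<integral>x. ?Q x y \<partial>lborel \<partial>lborel)"
    by simp
  moreover have "(\<integral>x. ?Q x y \<partial>lborel) = f y * (\<integral>x. k (y - x) * g x \<partial>lborel)" for y
    by (subst integral_mult_right_zero[symmetric]) (simp add: mult_ac)
  ultimately show ?thesis by (simp add: correlation_def)
qed

section \<open>Integration by parts and total variation\<close>

lemma nn_integral_translate:
  fixes c :: "'a::euclidean_space"
  assumes [measurable]: "f \<in> borel_measurable borel"
  shows "(\<integral>\<^sup>+x. f (x + c) \<partial>lborel) = (\<integral>\<^sup>+x. f x \<partial>lborel)"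
proof -
  have "(\<integral>\<^sup>+x. f x \<partial>lborel) = (\<integral>\<^sup>+x. f x \<partial>distr lborel borel ((+) c))"
    by (simp only: lborel_distr_plus)
  also have "\<dots> = (\<integral>\<^sup>+x. f (c + x) \<partial>lborel)"
    by (subst nn_integral_distr) auto
  finally show ?thesis by (simp add: add.commute)
qed

lemma integral_translate:
  fixes c :: "'a::euclidean_space" and f :: "'a \<Rightarrow> 'b::euclidean_space"
  assumes [measurable]: "f \<in> borel_measurable borel"
  shows "(\<integral>x. f (x + c) \<partial>lborel) = (\<integral>x. f x \<partial>lborel)"
proof -
  have "(\<integral>x. f x \<partial>lborel) = (\<integral>x. f x \<partial>distr lborel borel ((+) c))"
    by (simp only: lborel_distr_plus)
  also have "\<dots> = (\<integral>x. f (c + x) \<partial>lborel)"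
    by (subst integral_distr) auto
  finally show ?thesis by (simp add: add.commute)
qed

lemma nn_integral_le_of_cballs:
  fixes u :: "'a::euclidean_space \<Rightarrow> ennreal"
  assumes [measurable]: "u \<in> borel_measurable borel"
    and le: "\<And>n::nat. (\<integral>\<^sup>+x. u x * indicator (cball 0 (real n)) x \<partial>lborel) \<le> C"
  shows "(\<integral>\<^sup>+x. u x \<partial>lborel) \<le> C"
proof -
  have "u x \<le> (SUP n. u x * indicator (cball 0 (real n)) x)" for x
  proof -
    obtain n where "norm x \<le> real n" using real_arch_simple by blast
    then show ?thesis by (intro SUP_upper2[of n]) auto
  qed
  then have "(\<integral>\<^sup>+x. u x \<partial>lborel) \<le> (\<integral>\<^sup>+x. (SUP n. u x * indicator (cball 0 (real n)) x) \<partial>lborel)"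
    by (intro nn_integral_mono) auto
  also have "\<dots> = (SUP n. \<integral>\<^sup>+x. u x * indicator (cball 0 (real n)) x \<partial>lborel)"
    by (intro nn_integral_monotone_convergence_SUP)
      (auto simp: incseq_def le_fun_def indicator_def)
  also have "\<dots> \<le> C" by (intro SUP_least le)
  finally show ?thesis .
qed

text \<open>Translation invariance makes the integral of \<open>w (x + t v) - w x\<close> vanish, and by uniform
differentiability this difference is \<open>t\<close> times the derivative up to \<open>o(t)\<close>, uniformly and within one
fixed ball.\<close>

lemma integral_derivative_eq_0:
  fixes w :: "'a::euclidean_space \<Rightarrow> real"
  assumes w: "Ck (Suc 0) w" "bounded {x. w x \<noteq> 0}"
  shows "(\<integral>x. frechet_derivative w (at x) v \<partial>lborel) = 0" (is "?I = 0")
proof (rule ccontr)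
  assume "?I \<noteq> 0"
  obtain r where r: "closure {x. w x \<noteq> 0} \<subseteq> cball 0 r"
    by (rule bounded_support_cball[OF bounded_closure[OF w(2)]])
  define C where "C = cball (0::'a) (r + 1)"
  define m where "m = measure lborel C"
  \<comment> \<open>chosen so that the error \<open>e * norm v * m\<close> found below is at most half of the integral\<close>
  define e where "e = \<bar>?I\<bar> / (2 * (norm v * m + 1))"
  have m: "norm v * m \<ge> 0" by (simp add: m_def)
  then have "e > 0" using \<open>?I \<noteq> 0\<close> by (simp add: e_def)
  then obtain d where d: "d > 0" "\<And>x u. norm u < d \<Longrightarrow>
      \<bar>w (x + u) - w x - frechet_derivative w (at x) u\<bar> \<le> e * norm u"
    using uniform_differentiability[OF w] by blast
  \<comment> \<open>the increment \<open>t *\<^sub>R v\<close> is shorter than \<open>d\<close>, and than 1 so that it moves the support by less than 1\<close>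
  define t where "t = min d 1 / (norm v + 1) / 2"
  have "t > 0" using d(1) by (auto simp: t_def intro!: divide_pos_pos add_nonneg_pos)
  have "t * norm v \<le> min d 1 / 2"
  proof -
    have "norm v + 1 > 0" by (simp add: add_nonneg_pos)
    then have "norm v / (norm v + 1) \<le> 1" by (subst divide_le_eq_1) simp
    then have "min d 1 / 2 * (norm v / (norm v + 1)) \<le> min d 1 / 2 * 1"
      using d(1) by (intro mult_left_mono) auto
    then show ?thesis by (simp add: t_def mult.commute)
  qed
  then have t: "norm (t *\<^sub>R v) < d" "norm (t *\<^sub>R v) < 1"
    using \<open>t > 0\<close> d(1) by auto
  let ?D = "\<lambda>x. frechet_derivative w (at x) v"
  have lin: "frechet_derivative w (at x) (t *\<^sub>R v) = t * ?D x" for x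
    using linear_cmul[OF linear_frechet_derivative[of w "at x"], of t v] w(1) by simp
  have [measurable]: "w \<in> borel_measurable borel"
    using Ck_continuous[OF w(1)] by (simp add: borel_measurable_continuous_onI)
  have intD: "integrable lborel ?D"
    using w by (intro integrable_continuous_bounded_support bounded_support_derivative) auto
  have intw: "integrable lborel w"
    by (rule integrable_continuous_bounded_support[OF Ck_continuous[OF w(1)] w(2)])
  have intw': "integrable lborel (\<lambda>x. w (x + t *\<^sub>R v))"
    using integrable_kernel_L1_loc[OF L1_loc_continuous[of "\<lambda>x. 1::real"] Ck_continuous[OF w(1)] w(2), of "- (t *\<^sub>R v)"]
    by simp
  let ?R = "\<lambda>x. w (x + t *\<^sub>R v) - w x - t * ?D x"
  have R: "\<bar>?R x\<bar> \<le> e * (t * norm v) * indicator C x" for x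
  proof (cases "x \<in> C")
    case True
    then show ?thesis using d(2)[OF t(1), of x] \<open>t > 0\<close> by (simp add: lin)
  next
    case False
    then have "norm x > r + 1" by (simp add: C_def)
    then have "norm x > r" "norm (x + t *\<^sub>R v) > r"
      using norm_triangle_ineq2[of x "- (t *\<^sub>R v)"] t(2) by auto
    then have *: "x \<notin> closure {x. w x \<noteq> 0}" "x + t *\<^sub>R v \<notin> closure {x. w x \<noteq> 0}"
      using r by auto
    have "w x = 0" "w (x + t *\<^sub>R v) = 0"
      using zero_outside_support[OF *(1)] zero_outside_support[OF *(2)] by simp_all
    then show ?thesis using frechet_derivative_eq_0[OF *(1)] False by simp
  qed
  have "(\<integral>x. ?R x \<partial>lborel) = - t * ?I"
    using intD intw intw' by (simp add: integral_translate)
  then have "t * \<bar>?I\<bar> = norm (\<integral>x. ?R x \<partial>lborel)"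
    using \<open>t > 0\<close> by (simp add: abs_mult)
  also have "\<dots> \<le> (\<integral>x. e * (t * norm v) * indicator C x \<partial>lborel)"
  proof (rule Bochner_Integration.integral_norm_bound_integral)
    show "integrable lborel ?R" using intD intw intw' by simp
    show "integrable lborel (\<lambda>x. e * (t * norm v) * indicator C x)"
      by (intro integrable_mult_right integrable_real_indicator)
        (use emeasure_bounded_finite[OF bounded_cball, of 0 "r + 1"] in \<open>auto simp: C_def\<close>)
  qed (use R in simp)
  also have "\<dots> = t * (e * (norm v * m))"
    by (simp add: m_def)
  finally have "\<bar>?I\<bar> \<le> e * (norm v * m)" using \<open>t > 0\<close> by simp
  also have "\<dots> \<le> e * (norm v * m + 1)" using \<open>e > 0\<close> by (intro mult_left_mono) auto
  also have "\<dots> = \<bar>?I\<bar> / 2" using m by (simp add: e_def field_simps)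
  finally show False using \<open>?I \<noteq> 0\<close> by simp
qed

lemma div_field_continuous_bounded_support:
  assumes "\<Phi> \<in> Cc_infty"
  shows "continuous_on UNIV (div_field \<Phi>)" "bounded {x. div_field \<Phi> x \<noteq> 0}"
proof -
  have \<Phi>: "Ck (Suc 0) \<Phi>" "bounded {x. \<Phi> x \<noteq> 0}"
    using assms unfolding Cc_infty_iff by blast+
  show "continuous_on UNIV (div_field \<Phi>)"
    unfolding div_field_def using \<Phi>(1) by (intro continuous_intros) auto
  show "bounded {x. div_field \<Phi> x \<noteq> 0}"
  proof (rule bounded_subset[OF bounded_closure[OF \<Phi>(2)]], safe)
    fix x assume "div_field \<Phi> x \<noteq> 0"
    then show "x \<in> closure {x. \<Phi> x \<noteq> 0}"
      by (rule contrapos_np) (simp add: div_field_def frechet_derivative_eq_0)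
  qed
qed

lemma integrable_mult_div_field:
  assumes "L1_loc f" "\<Phi> \<in> Cc_infty"
  shows "integrable lborel (\<lambda>x. f x * div_field \<Phi> x)"
  using integrable_kernel_L1_loc[OF assms(1) div_field_continuous_bounded_support[OF assms(2)], of 0]
  by (simp add: mult.commute)

text \<open>The products \<open>u (\<Phi> \<bullet> b)\<close> have bounded support, so their derivatives in direction \<open>b\<close> integrate to 0; summing
over the basis gives integration by parts.\<close>

lemma divergence_theorem_product:
  fixes u :: "'a::euclidean_space \<Rightarrow> real"
  assumes u: "Ck (Suc 0) u" and \<Phi>: "\<Phi> \<in> Cc_infty"
  shows "integrable lborel (\<lambda>x. gradient u x \<bullet> \<Phi> x)"
    and "(\<integral>x. u x * div_field \<Phi> x \<partial>lborel) = - (\<integral>x. gradient u x \<bullet> \<Phi> x \<partial>lborel)"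
proof -
  have \<Phi>': "Ck (Suc 0) \<Phi>" "bounded {x. \<Phi> x \<noteq> 0}" using \<Phi> unfolding Cc_infty_iff by blast+
  have "bounded {x. gradient u x \<bullet> \<Phi> x \<noteq> 0}"
    by (rule bounded_subset[OF \<Phi>'(2)]) auto
  then show int1: "integrable lborel (\<lambda>x. gradient u x \<bullet> \<Phi> x)"
    using u \<Phi>'(1)
    by (intro integrable_continuous_bounded_support continuous_intros continuous_gradient)
      (blast intro: Ck_continuous)+
  have int2: "integrable lborel (\<lambda>x. u x * div_field \<Phi> x)"
    by (rule integrable_mult_div_field[OF L1_loc_continuous[OF Ck_continuous[OF u]] \<Phi>])
  let ?w = "\<lambda>b x. u x * (\<Phi> x \<bullet> b)"
  have Ckw: "Ck (Suc 0) (?w b)" for b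
    by (rule Ck_mult[OF u Ck_bounded_linear[OF bounded_linear_inner_left \<Phi>'(1)]])
  have bw: "bounded {x. ?w b x \<noteq> 0}" for b
    by (rule bounded_subset[OF \<Phi>'(2)]) auto
  have D: "frechet_derivative (?w b) (at x) b
      = u x * (frechet_derivative \<Phi> (at x) b \<bullet> b) + (gradient u x \<bullet> b) * (\<Phi> x \<bullet> b)" for b x
  proof -
    have "(?w b has_derivative (\<lambda>v. u x * (frechet_derivative \<Phi> (at x) v \<bullet> b)
        + frechet_derivative u (at x) v * (\<Phi> x \<bullet> b))) (at x)"
      by (rule has_derivative_mult[OF Ck_has_derivative[OF u]
            bounded_linear.has_derivative[OF bounded_linear_inner_left Ck_has_derivative[OF \<Phi>'(1)]]])
    from frechet_derivative_at[OF this, symmetric] show ?thesis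
      by (simp only: gradient_inner[OF u])
  qed
  have "0 = (\<Sum>b\<in>Basis. \<integral>x. frechet_derivative (?w b) (at x) b \<partial>lborel)"
    by (simp only: integral_derivative_eq_0[OF Ckw bw] sum.neutral_const)
  also have "\<dots> = (\<integral>x. (\<Sum>b\<in>Basis. frechet_derivative (?w b) (at x) b) \<partial>lborel)"
    using Ckw bw
    by (intro Bochner_Integration.integral_sum[symmetric] integrable_continuous_bounded_support
        bounded_support_derivative) auto
  also have "\<dots> = (\<integral>x. u x * div_field \<Phi> x + gradient u x \<bullet> \<Phi> x \<partial>lborel)"
    by (simp only: D sum.distrib div_field_def sum_distrib_left
        euclidean_inner[of "gradient u _" "\<Phi> _"])
  also have "\<dots> = (\<integral>x. u x * div_field \<Phi> x \<partial>lborel) + (\<integral>x. gradient u x \<bullet> \<Phi> x \<partial>lborel)"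
    by (rule Bochner_Integration.integral_add[OF int2 int1])
  finally show "(\<integral>x. u x * div_field \<Phi> x \<partial>lborel) = - (\<integral>x. gradient u x \<bullet> \<Phi> x \<partial>lborel)"
    by simp
qed

lemma total_var_ge:
  assumes f: "L1_loc f" and \<Phi>: "\<Phi> \<in> Cc_infty" "\<And>x. norm (\<Phi> x) \<le> 1"
  shows "ennreal (\<integral>x. f x * div_field \<Phi> x \<partial>lborel) \<le> total_var f"
proof -
  have "(\<integral>x. f x * div_field \<Phi> x \<partial>lborel) = (\<integral>x. f x * div_field \<Phi> x \<partial>lebesgue)"
    using integrable_mult_div_field[OF f \<Phi>(1)] by (intro integral_completion[symmetric]) auto
  then show ?thesis
    unfolding total_var_def using \<Phi> by (auto intro: SUP_upper)
qed

lemma total_var_le: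
  assumes f: "L1_loc f" and
    "\<And>\<Phi>. \<Phi> \<in> Cc_infty \<Longrightarrow> (\<And>x. norm (\<Phi> x) \<le> 1) \<Longrightarrow> ennreal (\<integral>x. f x * div_field \<Phi> x \<partial>lborel) \<le> V"
  shows "total_var f \<le> V"
  unfolding total_var_def
proof (rule SUP_least, safe)
  fix \<Phi> :: "'a \<Rightarrow> 'a" assume \<Phi>: "\<Phi> \<in> Cc_infty" "\<forall>x. norm (\<Phi> x) \<le> 1"
  have "(\<integral>x. f x * div_field \<Phi> x \<partial>lborel) = (\<integral>x. f x * div_field \<Phi> x \<partial>lebesgue)"
    using integrable_mult_div_field[OF f \<Phi>(1)] by (intro integral_completion[symmetric]) auto
  then show "ennreal (\<integral>x. f x * div_field \<Phi> x \<partial>lebesgue) \<le> V"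
    using assms(2)[OF \<Phi>(1)] \<Phi>(2) by simp
qed

section \<open>Mollifiers\<close>

definition mollifier :: "real \<Rightarrow> ('a::euclidean_space \<Rightarrow> real) \<Rightarrow> bool" where
  "mollifier e \<eta> \<longleftrightarrow> \<eta> \<in> Cc_infty \<and> (\<forall>x. 0 \<le> \<eta> x) \<and> (\<forall>x. \<eta> (- x) = \<eta> x) \<and>
     (\<forall>x. \<eta> x \<noteq> 0 \<longrightarrow> norm x \<le> e) \<and> (\<integral>x. \<eta> x \<partial>lborel) = 1"

text \<open>The flat function of \<open>e\<^sup>2 - |x|\<^sup>2\<close> is smooth and positive exactly on the ball of radius \<open>e\<close>; dividing by
its integral normalises it.\<close>

lemma mollifier_exists:
  assumes "e > 0"
  obtains \<eta> :: "'a::euclidean_space \<Rightarrow> real" where "mollifier e \<eta>"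
proof -
  define g where "g x = flat 1 (e\<^sup>2 + - 1 * (x \<bullet> x))" for x :: 'a
  have Ckg: "Ck k g" for k
    unfolding g_def by (intro Ck_compose[OF Ck_flat] Ck_add Ck_mult Ck_const Ck_norm_squared)
  have pos: "g x \<ge> 0" for x by (simp add: g_def flat_def)
  have nz: "g x \<noteq> 0 \<longleftrightarrow> norm x < e" for x
  proof -
    have "g x \<noteq> 0 \<longleftrightarrow> (norm x)\<^sup>2 < e\<^sup>2" by (simp add: g_def flat_def power2_norm_eq_inner)
    also have "\<dots> \<longleftrightarrow> norm x < e"
      using assms by (meson less_eq_real_def norm_ge_zero power2_less_imp_less power_strict_mono zero_less_numeral)
    finally show ?thesis .
  qed
  have supp: "{x. g x \<noteq> 0} = ball 0 e" by (simp only: nz) (simp add: ball_def)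
  have b: "bounded {x. g x \<noteq> 0}" unfolding supp by (rule bounded_ball)
  have int: "integrable lborel g"
    by (rule integrable_continuous_bounded_support[OF Ck_continuous[OF Ckg] b])
  define I where "I = (\<integral>x. g x \<partial>lborel)"
  have "I \<noteq> 0"
  proof
    assume "I = 0"
    then have "AE x in lborel. g x = 0"
      using int pos by (simp add: I_def integral_nonneg_eq_0_iff_AE)
    then have "{x. g x \<noteq> 0} \<in> null_sets lborel"
      using int by (simp add: AE_iff_null)
    then have "negligible (ball (0::'a) e)"
      unfolding supp negligible_iff_null_sets by (simp add: null_sets_completionI)
    then show False using open_not_negligible[of "ball (0::'a) e"] assms by simp
  qed
  moreover have "I \<ge> 0" unfolding I_def using pos by (intro integral_nonneg_AE) auto
  ultimately have I: "I > 0" by simp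
  have "mollifier e (\<lambda>x. g x * (1 / I))"
    unfolding mollifier_def Cc_infty_iff
  proof (intro conjI allI impI Ck_mult Ckg Ck_const)
    show "bounded {x. g x * (1 / I) \<noteq> 0}"
      by (rule bounded_subset[OF b]) auto
    show "(\<integral>x. g x * (1 / I) \<partial>lborel) = 1"
      using I by (simp add: I_def[symmetric])
    show "0 \<le> g x * (1 / I)" for x using pos I by simp
    show "g (- x) * (1 / I) = g x * (1 / I)" for x by (simp add: g_def)
    show "norm x \<le> e" if "g x * (1 / I) \<noteq> 0" for x using that nz[of x] by simp
  qed
  then show ?thesis by (rule that)
qed

lemma mollifierD:
  assumes "mollifier e \<eta>"
  shows "\<eta> \<in> Cc_infty" "\<And>k. Ck k \<eta>" "continuous_on UNIV \<eta>" "bounded {x. \<eta> x \<noteq> 0}"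
    "\<And>x. 0 \<le> \<eta> x" "\<And>x. \<eta> (- x) = \<eta> x" "\<And>x. \<eta> x \<noteq> 0 \<Longrightarrow> norm x \<le> e"
    "integrable lborel \<eta>" "(\<integral>x. \<eta> x \<partial>lborel) = 1" "\<eta> \<in> borel_measurable borel"
    "integrable lborel (\<lambda>y. \<eta> (y - x))" "(\<integral>y. \<eta> (y - x) \<partial>lborel) = 1"
proof -
  show *: "\<eta> \<in> Cc_infty" "\<And>x. 0 \<le> \<eta> x" "\<And>x. \<eta> (- x) = \<eta> x" "\<And>x. \<eta> x \<noteq> 0 \<Longrightarrow> norm x \<le> e"
    "(\<integral>x. \<eta> x \<partial>lborel) = 1"
    using assms unfolding mollifier_def by blast+
  show C: "\<And>k. Ck k \<eta>" and b: "bounded {x. \<eta> x \<noteq> 0}"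
    using *(1) unfolding Cc_infty_iff by blast+
  show c: "continuous_on UNIV \<eta>" by (rule Ck_continuous[OF C])
  show "integrable lborel \<eta>" by (rule integrable_continuous_bounded_support[OF c b])
  show [measurable]: "\<eta> \<in> borel_measurable borel" by (rule borel_measurable_continuous_onI[OF c])
  show "integrable lborel (\<lambda>y. \<eta> (y - x))"
    using integrable_kernel_L1_loc[OF L1_loc_continuous[of "\<lambda>x. 1::real"] c b] by simp
  show "(\<integral>y. \<eta> (y - x) \<partial>lborel) = 1"
    using integral_translate[of \<eta> "- x"] *(5) by simp
qed

lemma norm_mollified_le:
  assumes \<eta>: "mollifier e \<eta>" and f: "L1_loc f" "\<And>x. norm (f x) \<le> 1"
  shows "norm (correlation \<eta> f x) \<le> 1"
proof -
  have "norm (correlation \<eta> f x) \<le> (\<integral>y. \<eta> (y - x) \<partial>lborel)"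
    unfolding correlation_def
  proof (rule Bochner_Integration.integral_norm_bound_integral)
    show "norm (\<eta> (y - x) *\<^sub>R f y) \<le> \<eta> (y - x)" for y
      using mult_left_mono[OF f(2)[of y] mollifierD(5)[OF \<eta>, of "y - x"]] mollifierD(5)[OF \<eta>, of "y - x"]
      by simp
  qed (intro integrable_kernel_L1_loc f mollifierD[OF \<eta>])+
  then show ?thesis by (simp add: mollifierD[OF \<eta>])
qed

text \<open>Evenness of the kernel makes its derivative odd, which is what lets a derivative pass from one factor of
a correlation to the other.\<close>

lemma mollifier_derivative_odd:
  assumes "mollifier e \<eta>"
  shows "frechet_derivative \<eta> (at (- z)) (- v) = frechet_derivative \<eta> (at z) v"
proof -
  have "(\<eta> has_derivative frechet_derivative \<eta> (at (- z))) (at (- z))"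
    using Ck_has_derivative[OF mollifierD(2)[OF assms]] .
  from has_derivative_compose[OF has_derivative_minus[OF has_derivative_ident] this]
  have "((\<lambda>x. \<eta> (- x)) has_derivative (\<lambda>v. frechet_derivative \<eta> (at (- z)) (- v))) (at z)" .
  then have "(\<eta> has_derivative (\<lambda>v. frechet_derivative \<eta> (at (- z)) (- v))) (at z)"
    by (simp only: mollifierD(6)[OF assms])
  from frechet_derivative_at[OF this] show ?thesis by metis
qed

text \<open>The gradient of the mollification is paired with the measurable field \<open>\<Psi> = - \<nabla>h / |\<nabla>h|\<close> on a ball. Moving the
kernel to the other side turns this pairing into \<open>f\<close> tested with the divergence of the mollified \<open>\<Psi>\<close>,
which is a smooth field of norm at most 1.\<close>

lemma integral_norm_gradient_mollified_le:
  fixes f :: "'a::euclidean_space \<Rightarrow> real"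
  assumes f: "L1_loc f" and \<eta>: "mollifier e \<eta>"
  shows "(\<integral>\<^sup>+x. ennreal (norm (gradient (correlation \<eta> f) x)) \<partial>lborel) \<le> total_var f"
proof (rule nn_integral_le_of_cballs)
  let ?h = "correlation \<eta> f"
  have Ckh: "Ck n ?h" for n by (rule Ck_correlation[OF f mollifierD(1)[OF \<eta>]])
  have cont: "continuous_on UNIV (gradient ?h)" by (rule continuous_gradient[OF Ckh])
  then have [measurable]: "gradient ?h \<in> borel_measurable borel"
    by (rule borel_measurable_continuous_onI)
  then show "(\<lambda>x. ennreal (norm (gradient ?h x))) \<in> borel_measurable borel" by measurable
  fix n :: nat
  \<comment> \<open>the sign compensates the one from integration by parts\<close>
  define \<Psi> where "\<Psi> x = (- indicator (cball 0 (real n)) x :: real) *\<^sub>R sgn (gradient ?h x)" for x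
  have "(\<lambda>x. sgn (gradient ?h x)) \<in> borel_measurable borel"
    by (rule measurable_compose[OF _ borel_measurable_sgn]) measurable
  then have [measurable]: "\<Psi> \<in> borel_measurable borel"
    unfolding \<Psi>_def by (intro borel_measurable_scaleR borel_measurable_uminus borel_measurable_indicator) auto
  have \<Psi>1: "norm (\<Psi> x) \<le> 1" for x by (auto simp: \<Psi>_def norm_sgn indicator_def)
  have \<Psi>L: "L1_loc \<Psi>" by (rule L1_loc_bounded[OF _ \<Psi>1]) measurable
  have \<Psi>b: "bounded {x. \<Psi> x \<noteq> 0}"
    by (rule bounded_subset[OF bounded_cball[of 0 "real n"]]) (auto simp: \<Psi>_def indicator_def)
  have \<Psi>bL: "L1_loc (\<lambda>x. \<Psi> x \<bullet> b)" if "b \<in> Basis" for b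
    using order_trans[OF Basis_le_norm[OF that] \<Psi>1] by (intro L1_loc_bounded[of _ 1]) auto
  have \<Psi>bb: "bounded {x. \<Psi> x \<bullet> b \<noteq> 0}" for b
    by (rule bounded_subset[OF \<Psi>b]) auto
  define \<kappa> where "\<kappa> b z = frechet_derivative \<eta> (at z) (- b)" for b z
  have \<kappa>: "\<kappa> b \<in> Cc_infty" for b
    unfolding \<kappa>_def by (intro Cc_infty_derivative mollifierD[OF \<eta>])
  have \<kappa>c: "continuous_on UNIV (\<kappa> b)" and \<kappa>b: "bounded {x. \<kappa> b x \<noteq> 0}" for b
    using \<kappa>[of b] Ck_continuous unfolding Cc_infty_iff by blast+
  have \<kappa>odd: "\<kappa> b (x - y) = - \<kappa> b (y - x)" for b x y
  proof -
    have "linear (frechet_derivative \<eta> (at (x - y)))"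
      using mollifierD(2)[OF \<eta>, of "Suc 0"] by (intro linear_frechet_derivative) simp
    then show ?thesis
      using mollifier_derivative_odd[OF \<eta>, of "x - y" b]
      by (simp add: \<kappa>_def linear_neg)
  qed
  have D: "frechet_derivative (correlation \<eta> g) (at x) b = correlation (\<kappa> b) g x"
    if "L1_loc g" for g :: "'a \<Rightarrow> 'b::euclidean_space" and x b
    unfolding \<kappa>_def
    by (intro frechet_derivative_correlation that mollifierD[OF \<eta>])
  define \<Phi> where "\<Phi> = correlation \<eta> \<Psi>"
  have \<Phi>: "\<Phi> \<in> Cc_infty"
    unfolding \<Phi>_def by (intro correlation_Cc_infty \<Psi>L \<Psi>b mollifierD[OF \<eta>])
  have \<Phi>1: "norm (\<Phi> x) \<le> 1" for x
    unfolding \<Phi>_def by (intro norm_mollified_le[OF \<eta>] \<Psi>L \<Psi>1)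
  have div: "div_field \<Phi> y = (\<Sum>b\<in>Basis. - (\<integral>x. \<kappa> b (y - x) * (\<Psi> x \<bullet> b) \<partial>lborel))" for y
  proof -
    have "correlation (\<kappa> b) \<Psi> y \<bullet> b = - (\<integral>x. \<kappa> b (y - x) * (\<Psi> x \<bullet> b) \<partial>lborel)" for b
    proof -
      have "correlation (\<kappa> b) \<Psi> y \<bullet> b = (\<integral>x. (\<kappa> b (x - y) *\<^sub>R \<Psi> x) \<bullet> b \<partial>lborel)"
        unfolding correlation_def
        by (intro integral_inner_left[symmetric] integrable_kernel_L1_loc \<Psi>L \<kappa>c \<kappa>b)
      then show ?thesis by (simp add: \<kappa>odd[of b _ y])
    qed
    then show ?thesis by (simp add: div_field_def \<Phi>_def D[OF \<Psi>L])
  qed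
  have int1: "integrable lborel (\<lambda>y. f y * (\<integral>x. \<kappa> b (y - x) * (\<Psi> x \<bullet> b) \<partial>lborel))" if b: "b \<in> Basis" for b
  proof -
    have "correlation (\<kappa> b) (\<lambda>x. \<Psi> x \<bullet> b) \<in> Cc_infty"
      by (rule correlation_Cc_infty[OF \<Psi>bL[OF b] \<kappa> \<Psi>bb])
    then have "continuous_on UNIV (correlation (\<kappa> b) (\<lambda>x. \<Psi> x \<bullet> b))"
      "bounded {x. correlation (\<kappa> b) (\<lambda>x. \<Psi> x \<bullet> b) x \<noteq> 0}"
      unfolding Cc_infty_iff using Ck_continuous by blast+
    from integrable_kernel_L1_loc[OF f this, of 0]
    have "integrable lborel (\<lambda>y. f y * - correlation (\<kappa> b) (\<lambda>x. \<Psi> x \<bullet> b) y)"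
      by (simp add: mult.commute)
    moreover have "- correlation (\<kappa> b) (\<lambda>x. \<Psi> x \<bullet> b) y = (\<integral>x. \<kappa> b (y - x) * (\<Psi> x \<bullet> b) \<partial>lborel)" for y
      by (simp add: correlation_def \<kappa>odd[of b _ y])
    ultimately show ?thesis by simp
  qed
  have int2: "integrable lborel (\<lambda>x. correlation (\<kappa> b) f x * (\<Psi> x \<bullet> b))" if b: "b \<in> Basis" for b
  proof -
    have "L1_loc (correlation (\<kappa> b) f)"
      by (intro L1_loc_continuous Ck_continuous[where k=0] Ck_correlation[OF f \<kappa>])
    from integrable_scaleR_L1_loc[OF this, of "\<lambda>x. \<Psi> x \<bullet> b" 1] show ?thesis
      using \<Psi>bb[of b] order_trans[OF Basis_le_norm[OF b] \<Psi>1] by (simp add: mult.commute)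
  qed
  have "(\<integral>y. f y * div_field \<Phi> y \<partial>lborel)
      = (\<integral>y. (\<Sum>b\<in>Basis. - (f y * (\<integral>x. \<kappa> b (y - x) * (\<Psi> x \<bullet> b) \<partial>lborel))) \<partial>lborel)"
    by (simp add: div sum_distrib_left)
  also have "\<dots> = (\<Sum>b\<in>Basis. - (\<integral>y. f y * (\<integral>x. \<kappa> b (y - x) * (\<Psi> x \<bullet> b) \<partial>lborel) \<partial>lborel))"
    using int1 by (subst Bochner_Integration.integral_sum) auto
  also have "\<dots> = (\<Sum>b\<in>Basis. - (\<integral>x. correlation (\<kappa> b) f x * (\<Psi> x \<bullet> b) \<partial>lborel))"
    by (intro sum.cong refl) (simp add: integral_correlation_swap[OF f \<Psi>bL \<Psi>bb \<kappa>c \<kappa>b])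
  also have "\<dots> = (\<integral>x. (\<Sum>b\<in>Basis. - (correlation (\<kappa> b) f x * (\<Psi> x \<bullet> b))) \<partial>lborel)"
    using int2 by (subst Bochner_Integration.integral_sum) auto
  also have "\<dots> = (\<integral>x. norm (gradient ?h x) * indicator (cball 0 (real n)) x \<partial>lborel)"
  proof (rule Bochner_Integration.integral_cong[OF refl])
    fix x
    have "(\<Sum>b\<in>Basis. - (correlation (\<kappa> b) f x * (\<Psi> x \<bullet> b)))
        = - (\<Sum>b\<in>Basis. (gradient ?h x \<bullet> b) * (\<Psi> x \<bullet> b))"
      by (simp add: sum_negf D[OF f, symmetric] gradient_inner[OF Ckh])
    also have "\<dots> = - (gradient ?h x \<bullet> \<Psi> x)" by (simp only: euclidean_inner[of "gradient ?h x" "\<Psi> x"])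
    also have "\<dots> = norm (gradient ?h x) * indicator (cball 0 (real n)) x"
      by (cases "gradient ?h x = 0")
        (simp_all add: \<Psi>_def sgn_div_norm power2_norm_eq_inner[symmetric] power2_eq_square)
    finally show "(\<Sum>b\<in>Basis. - (correlation (\<kappa> b) f x * (\<Psi> x \<bullet> b)))
      = norm (gradient ?h x) * indicator (cball 0 (real n)) x" .
  qed
  finally have eq: "(\<integral>y. f y * div_field \<Phi> y \<partial>lborel)
      = (\<integral>x. norm (gradient ?h x) * indicator (cball 0 (real n)) x \<partial>lborel)" .
  have "integrable lborel (\<lambda>x. indicator (cball 0 (real n)) x *\<^sub>R gradient ?h x)"
    using L1_loc_continuous[OF cont] by (simp add: L1_loc_def set_integrable_def)
  from integrable_norm[OF this]
  have "integrable lborel (\<lambda>x. norm (gradient ?h x) * indicator (cball 0 (real n)) x)"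
    by (simp add: mult.commute)
  then have "(\<integral>\<^sup>+x. ennreal (norm (gradient ?h x) * indicator (cball 0 (real n)) x) \<partial>lborel)
      = ennreal (\<integral>y. f y * div_field \<Phi> y \<partial>lborel)"
    unfolding eq by (intro nn_integral_eq_integral) auto
  also have "\<dots> \<le> total_var f" by (rule total_var_ge[OF f \<Phi> \<Phi>1])
  finally show "(\<integral>\<^sup>+x. ennreal (norm (gradient ?h x)) * indicator (cball 0 (real n)) x \<partial>lborel) \<le> total_var f"
    by (simp add: ennreal_mult' ennreal_indicator)
qed

section \<open>Translation estimate and convergence of mollifications\<close>

lemma L1_loc_translate:
  fixes f :: "'a::euclidean_space \<Rightarrow> real"
  assumes f: "L1_loc f"
  shows "L1_loc (\<lambda>x. f (x + z))"
  unfolding L1_loc_def set_integrable_def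
proof safe
  have [measurable]: "f \<in> borel_measurable borel" using f by (simp add: L1_loc_def)
  show "(\<lambda>x. f (x + z)) \<in> borel_measurable borel" by measurable
  fix r :: real
  have m: "indicat_real (cball z r) \<in> borel_measurable borel"
    by (intro borel_measurable_indicator) auto
  have "bounded {x. indicat_real (cball z r) x \<noteq> 0}"
    by (rule bounded_subset[OF bounded_cball[of z r]]) (auto simp: indicator_def)
  from integrable_scaleR_L1_loc[OF f m, of 1, OF _ this]
  have int: "integrable lborel (\<lambda>x. indicat_real (cball z r) x *\<^sub>R f x)"
    by (simp add: indicator_def)
  then have "integrable (distr lborel borel ((+) z)) (\<lambda>x. indicat_real (cball z r) x *\<^sub>R f x)"
    by (simp only: lborel_distr_plus)
  then have "integrable lborel (\<lambda>x. indicat_real (cball z r) (z + x) *\<^sub>R f (z + x))"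
    by (rule integrable_distr[rotated]) simp
  then show "integrable lborel (\<lambda>x. indicat_real (cball 0 r) x *\<^sub>R f (x + z))"
    by (simp add: indicator_def dist_norm add.commute)
qed

text \<open>The mean value theorem along \<open>s \<mapsto> \<integral> g (x - s z) f x\<close>: the derivative at \<open>s\<close> is \<open>|z|\<close> times the integral of
\<open>f div \<Phi>\<close> for the field \<open>\<Phi>\<close> obtained by multiplying the translate of \<open>g\<close> with the unit vector \<open>- z / |z|\<close>.\<close>

lemma translation_test_le:
  fixes f g :: "'a::euclidean_space \<Rightarrow> real"
  assumes f: "L1_loc f" and fin: "total_var f < \<infinity>"
    and g: "g \<in> Cc_infty" "\<And>x. \<bar>g x\<bar> \<le> 1"
  shows "(\<integral>x. g (x - z) * f x \<partial>lborel) - (\<integral>x. g x * f x \<partial>lborel) \<le> norm z * enn2real (total_var f)"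
proof -
  have Ckg: "\<And>k. Ck k g" and gb: "bounded {x. g x \<noteq> 0}"
    using g(1) unfolding Cc_infty_iff by blast+
  let ?\<kappa> = "\<lambda>u. frechet_derivative g (at u) (- z)"
  have lin: "linear (frechet_derivative g (at u))" for u
    using Ckg[of "Suc 0"] by (intro linear_frechet_derivative) simp
  have deriv: "((\<lambda>s. correlation g f (s *\<^sub>R z)) has_real_derivative correlation ?\<kappa> f (s *\<^sub>R z)) (at s)" for s
  proof -
    have 1: "((\<lambda>s. s *\<^sub>R z) has_derivative (\<lambda>t. t *\<^sub>R z)) (at s)"
      by (auto intro!: derivative_eq_intros)
    have "correlation (\<lambda>u. frechet_derivative g (at u) (- (t *\<^sub>R z))) f x = correlation ?\<kappa> f x * t" for t x
    proof -
      have *: "frechet_derivative g (at u) (- (t *\<^sub>R z)) = t * ?\<kappa> u" for u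
        using linear_cmul[OF lin, of u t "- z"] by simp
      show ?thesis unfolding correlation_def * by (simp add: mult.commute mult.left_commute)
    qed
    then show ?thesis
      using has_derivative_compose[OF 1 correlation_has_derivative[OF f Ckg gb]]
      by (simp add: has_field_derivative_def)
  qed
  then obtain s where s: "correlation g f (1 *\<^sub>R z) - correlation g f (0 *\<^sub>R z) = (1 - 0) * correlation ?\<kappa> f (s *\<^sub>R z)"
    using MVT2[of 0 1 "\<lambda>s. correlation g f (s *\<^sub>R z)" "\<lambda>s. correlation ?\<kappa> f (s *\<^sub>R z)"] by auto
  define \<Phi> where "\<Phi> y = g (y + - (s *\<^sub>R z)) *\<^sub>R (- sgn z)" for y
  have "Ck k \<Phi>" for k
    unfolding \<Phi>_def by (rule Ck_bounded_linear[OF bounded_linear_scaleR_left Ck_translate[OF Ckg]])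
  moreover have "bounded {x. \<Phi> x \<noteq> 0}"
    by (rule bounded_subset[OF bounded_support_shift[OF gb, of "s *\<^sub>R z"]]) (auto simp: \<Phi>_def)
  ultimately have \<Phi>: "\<Phi> \<in> Cc_infty" by (simp add: Cc_infty_iff)
  have \<Phi>1: "norm (\<Phi> x) \<le> 1" for x
    using g(2) by (auto simp: \<Phi>_def norm_sgn)
  have div: "norm z * div_field \<Phi> y = ?\<kappa> (y - s *\<^sub>R z)" for y
  proof -
    let ?L = "frechet_derivative g (at (y + - (s *\<^sub>R z)))"
    have "((\<lambda>y. g (y + - (s *\<^sub>R z))) has_derivative ?L) (at y)"
      by (rule has_derivative_compose[where f="\<lambda>y. y + - (s *\<^sub>R z)" and f'="\<lambda>v. v"])
        (auto intro!: derivative_eq_intros Ck_has_derivative[OF Ckg] simp del: Ck.simps)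
    from bounded_linear.has_derivative[OF bounded_linear_scaleR_left[of "- sgn z"] this]
    have "(\<Phi> has_derivative (\<lambda>v. ?L v *\<^sub>R (- sgn z))) (at y)" unfolding \<Phi>_def .
    from frechet_derivative_at[OF this, symmetric]
    have "norm z * div_field \<Phi> y = (\<Sum>b\<in>Basis. norm z * (?L b * ((- sgn z) \<bullet> b)))"
      by (simp add: div_field_def sum_distrib_left)
    also have "\<dots> = (\<Sum>b\<in>Basis. ?L b * ((- z) \<bullet> b))"
      by (intro sum.cong refl) (cases "z = 0", simp_all add: sgn_div_norm)
    also have "\<dots> = ?L (\<Sum>b\<in>Basis. ((- z) \<bullet> b) *\<^sub>R b)"
      by (simp only: linear_sum[OF lin] linear_cmul[OF lin]) (simp add: mult.commute)
    also have "\<dots> = ?L (- z)" by (simp only: euclidean_representation)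
    finally show ?thesis by simp
  qed
  have "correlation ?\<kappa> f (s *\<^sub>R z) = (\<integral>y. norm z * (f y * div_field \<Phi> y) \<partial>lborel)"
    unfolding correlation_def by (simp add: div[symmetric] mult_ac)
  also have "\<dots> = norm z * (\<integral>y. f y * div_field \<Phi> y \<partial>lborel)" by simp
  also have "\<dots> \<le> norm z * enn2real (total_var f)"
  proof (rule mult_left_mono)
    have "enn2real (ennreal (\<integral>y. f y * div_field \<Phi> y \<partial>lborel)) \<le> enn2real (total_var f)"
      using total_var_ge[OF f \<Phi> \<Phi>1] fin by (intro enn2real_mono) auto
    then show "(\<integral>y. f y * div_field \<Phi> y \<partial>lborel) \<le> enn2real (total_var f)"
      by (cases "(\<integral>y. f y * div_field \<Phi> y \<partial>lborel) \<ge> 0") (auto intro: order_trans[OF _ enn2real_nonneg])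
  qed simp
  finally show ?thesis using s by (simp add: correlation_def)
qed

text \<open>Mollification at a scale below the one given by uniform continuity. The scale is also kept at most 1, so
that the value at \<open>x\<close> depends only on \<open>c\<close> within distance 1; the last conclusion controls supports by this.\<close>

lemma mollified_uniform_approximation:
  fixes c :: "'a::euclidean_space \<Rightarrow> real"
  assumes c: "continuous_on UNIV c" "bounded {x. c x \<noteq> 0}" "\<And>x. \<bar>c x\<bar> \<le> 1"
    and e: "e > 0"
  obtains G where "G \<in> Cc_infty" "\<And>x. \<bar>G x\<bar> \<le> 1" "\<And>x. \<bar>G x - c x\<bar> \<le> e"
    "\<And>x. (\<And>y. dist y x \<le> 1 \<Longrightarrow> c y = 0) \<Longrightarrow> G x = 0"
proof -
  have "uniformly_continuous_on UNIV c" by (rule uniformly_continuous_bounded_support[OF c(1,2)])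
  then obtain d where "d > 0" and d: "\<And>x y. x \<in> UNIV \<Longrightarrow> y \<in> UNIV \<Longrightarrow> dist y x < d \<Longrightarrow> dist (c y) (c x) < e"
    by (rule uniformly_continuous_onE[OF _ e]) (rule that, assumption, simp)
  obtain \<eta> :: "'a \<Rightarrow> real" where \<eta>: "mollifier (min 1 (d / 2)) \<eta>"
    using mollifier_exists[of "min 1 (d / 2)"] \<open>d > 0\<close> by auto
  have cL: "L1_loc c" by (rule L1_loc_continuous[OF c(1)])
  show ?thesis
  proof
    show "correlation \<eta> c \<in> Cc_infty"
      by (rule correlation_Cc_infty[OF cL mollifierD(1)[OF \<eta>] c(2)])
    show "\<bar>correlation \<eta> c x\<bar> \<le> 1" for x
      using norm_mollified_le[OF \<eta> cL] c(3) by simp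
    show "correlation \<eta> c x = 0" if "\<And>y. dist y x \<le> 1 \<Longrightarrow> c y = 0" for x
    proof -
      have "\<eta> (y - x) *\<^sub>R c y = 0" for y
        using that[of y] mollifierD(7)[OF \<eta>, of "y - x"] by (cases "\<eta> (y - x) = 0") (auto simp: dist_norm)
      then show ?thesis by (simp only: correlation_def Bochner_Integration.integral_zero)
    qed
    show "\<bar>correlation \<eta> c x - c x\<bar> \<le> e" for x
    proof -
      have int: "integrable lborel (\<lambda>y. \<eta> (y - x) * c y)"
        using integrable_kernel_L1_loc[OF cL mollifierD(3,4)[OF \<eta>]] by simp
      have "correlation \<eta> c x - c x = (\<integral>y. \<eta> (y - x) * c y \<partial>lborel) - (\<integral>y. \<eta> (y - x) * c x \<partial>lborel)"
        by (simp add: correlation_def mollifierD[OF \<eta>])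
      also have "\<dots> = (\<integral>y. \<eta> (y - x) * c y - \<eta> (y - x) * c x \<partial>lborel)"
        by (intro Bochner_Integration.integral_diff[symmetric] int integrable_mult_left mollifierD[OF \<eta>])
      also have "norm \<dots> \<le> (\<integral>y. \<eta> (y - x) * e \<partial>lborel)"
      proof (rule Bochner_Integration.integral_norm_bound_integral)
        show "integrable lborel (\<lambda>y. \<eta> (y - x) * c y - \<eta> (y - x) * c x)"
          by (intro Bochner_Integration.integrable_diff int integrable_mult_left mollifierD[OF \<eta>])
        show "integrable lborel (\<lambda>y. \<eta> (y - x) * e)"
          by (intro integrable_mult_left mollifierD[OF \<eta>])
        show "norm (\<eta> (y - x) * c y - \<eta> (y - x) * c x) \<le> \<eta> (y - x) * e" for y
        proof (cases "\<eta> (y - x) = 0")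
          case False
          then have "dist y x < d" using mollifierD(7)[OF \<eta>, of "y - x"] \<open>d > 0\<close> by (simp add: dist_norm)
          then have "\<bar>c y - c x\<bar> \<le> e" using d[OF UNIV_I UNIV_I] by (simp add: dist_real_def less_imp_le)
          then have "\<eta> (y - x) * \<bar>c y - c x\<bar> \<le> \<eta> (y - x) * e"
            by (intro mult_left_mono mollifierD[OF \<eta>])
          then show ?thesis
            by (simp add: right_diff_distrib[symmetric] abs_mult mollifierD[OF \<eta>])
        qed simp
      qed
      also have "\<dots> = e" by (simp add: mollifierD[OF \<eta>])
      finally show ?thesis by simp
    qed
  qed
qed

text \<open>Measurability gives continuous functions converging almost everywhere. Clipping to \<open>[-1, 1]\<close>, cutting off
outside a ball and mollifying at a scale given by uniform continuity keep the limit and make the sequence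
admissible as test functions with a common support.\<close>

lemma Cc_infty_AE_approximation:
  fixes \<sigma> :: "'a::euclidean_space \<Rightarrow> real"
  assumes [measurable]: "\<sigma> \<in> borel_measurable borel" and \<sigma>1: "\<And>x. \<bar>\<sigma> x\<bar> \<le> 1"
    and \<sigma>0: "\<And>x. norm x > r \<Longrightarrow> \<sigma> x = 0"
  obtains G :: "nat \<Rightarrow> 'a \<Rightarrow> real" where
    "\<And>n. G n \<in> Cc_infty" "\<And>n x. \<bar>G n x\<bar> \<le> 1" "\<And>n x. norm x > r + 2 \<Longrightarrow> G n x = 0" "AE x in lborel. (\<lambda>n. G n x) \<longlonglongrightarrow> \<sigma> x"
proof -
  have "\<sigma> measurable_on UNIV"
    by (rule lebesgue_measurable_imp_measurable_on) (auto intro: measurable_completion)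
  then obtain N g where N: "negligible N" and g: "\<And>n. continuous_on UNIV (g n)"
    "\<And>x. x \<notin> N \<Longrightarrow> (\<lambda>n. g n x) \<longlonglongrightarrow> \<sigma> x"
    unfolding measurable_on_def by auto
  define c where "c n x = max (- 1) (min 1 (g n x)) * max 0 (min 1 (r + 1 - norm x))" for n :: nat and x
  have cont: "continuous_on UNIV (c n)" for n
    unfolding c_def by (intro continuous_intros g)
  have supp: "bounded {x. c n x \<noteq> 0}" for n
    by (rule bounded_subset[OF bounded_cball[of 0 "r + 1"]]) (auto simp: c_def max_def split: if_splits)
  have c1: "\<bar>c n x\<bar> \<le> 1" for n x
    unfolding c_def abs_mult by (rule mult_le_one) auto
  \<comment> \<open>where \<open>\<sigma>\<close> is nonzero the cut-off equals 1, and clipping does not change \<open>\<sigma>\<close>\<close>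
  have lim: "(\<lambda>n. c n x) \<longlonglongrightarrow> \<sigma> x" if "x \<notin> N" for x
  proof -
    have "(\<lambda>n. c n x) \<longlonglongrightarrow> max (- 1) (min 1 (\<sigma> x)) * max 0 (min 1 (r + 1 - norm x))"
      unfolding c_def by (intro tendsto_intros g that)
    moreover have "max (- 1) (min 1 (\<sigma> x)) * max 0 (min 1 (r + 1 - norm x)) = \<sigma> x"
      using \<sigma>1[of x] \<sigma>0[of x] by (cases "norm x > r") auto
    ultimately show ?thesis by simp
  qed
  have c0: "c n x = 0" if "norm x > r + 1" for n x
    using that by (simp add: c_def)
  have "\<exists>G. G \<in> Cc_infty \<and> (\<forall>x. \<bar>G x\<bar> \<le> 1) \<and> (\<forall>x. \<bar>G x - c n x\<bar> \<le> inverse (real (Suc n))) \<and>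
      (\<forall>x. (\<forall>y. dist y x \<le> 1 \<longrightarrow> c n y = 0) \<longrightarrow> G x = 0)" for n
    by (rule mollified_uniform_approximation[OF cont[of n] supp[of n] c1[of n], of "inverse (real (Suc n))"]) auto
  then obtain G where G: "\<And>n. G n \<in> Cc_infty" "\<And>n x. \<bar>G n x\<bar> \<le> 1"
    "\<And>n x. \<bar>G n x - c n x\<bar> \<le> inverse (real (Suc n))"
    "\<And>n x. (\<forall>y. dist y x \<le> 1 \<longrightarrow> c n y = 0) \<Longrightarrow> G n x = 0"
    by metis
  have "G n x = 0" if "norm x > r + 2" for n x
  proof (rule G(4), safe)
    fix y assume "dist y x \<le> 1"
    then show "c n y = 0"
      using that norm_triangle_ineq2[of x y] by (intro c0) (simp add: dist_norm norm_minus_commute)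
  qed
  moreover have lim_G: "(\<lambda>n. G n x) \<longlonglongrightarrow> \<sigma> x" if "x \<notin> N" for x
  proof -
    have "(\<lambda>n. G n x - c n x) \<longlonglongrightarrow> 0"
      by (rule tendsto_rabs_zero_cancel[OF tendsto_sandwich[OF _ _ tendsto_const LIMSEQ_inverse_real_of_nat]])
        (use G(3) in auto)
    from tendsto_add[OF this lim[OF that]] show ?thesis by simp
  qed
  have "AE x in lebesgue. x \<notin> N"
    using N by (intro AE_not_in) (simp add: negligible_iff_null_sets)
  then have "AE x in lborel. x \<notin> N" by (simp add: AE_completion_iff)
  then have "AE x in lborel. (\<lambda>n. G n x) \<longlonglongrightarrow> \<sigma> x" using lim_G by auto
  ultimately show ?thesis using that G(1,2) by blast
qed

text \<open>The test functions approximate the sign of \<open>D\<close> on a ball, and dominated convergence gives the integral of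
\<open>|D|\<close> there.\<close>

lemma nn_integral_abs_le_by_duality:
  fixes D :: "'a::euclidean_space \<Rightarrow> real"
  assumes D: "L1_loc D" and C: "C \<ge> 0"
    and test: "\<And>g. g \<in> Cc_infty \<Longrightarrow> (\<And>x. \<bar>g x\<bar> \<le> 1) \<Longrightarrow> (\<integral>x. g x * D x \<partial>lborel) \<le> C"
  shows "(\<integral>\<^sup>+x. ennreal \<bar>D x\<bar> \<partial>lborel) \<le> ennreal C"
proof (rule nn_integral_le_of_cballs)
  have [measurable]: "D \<in> borel_measurable borel" using D by (simp add: L1_loc_def)
  show "(\<lambda>x. ennreal \<bar>D x\<bar>) \<in> borel_measurable borel" by measurable
  fix n :: nat
  let ?B = "cball (0::'a) (real n)"
  define \<sigma> where "\<sigma> x = indicator ?B x * sgn (D x)" for x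
  have [measurable]: "?B \<in> sets borel" by simp
  have \<sigma>m: "\<sigma> \<in> borel_measurable borel"
    unfolding \<sigma>_def by (intro borel_measurable_times borel_measurable_indicator
        measurable_compose[OF _ borel_measurable_sgn]) auto
  have \<sigma>1: "\<bar>\<sigma> x\<bar> \<le> 1" for x by (simp add: \<sigma>_def abs_mult indicator_def abs_sgn_eq)
  have \<sigma>0: "norm x > real n \<Longrightarrow> \<sigma> x = 0" for x by (simp add: \<sigma>_def)
  obtain G where G: "\<And>m. G m \<in> Cc_infty" "\<And>m x. \<bar>G m x\<bar> \<le> 1"
    "\<And>m x. norm x > real n + 2 \<Longrightarrow> G m x = 0" "AE x in lborel. (\<lambda>m. G m x) \<longlonglongrightarrow> \<sigma> x"
    by (rule Cc_infty_AE_approximation[where r="real n", OF \<sigma>m \<sigma>1 \<sigma>0], assumption) (rule that; simp)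
  have G_cont: "continuous_on UNIV (G m)" for m
    using G(1)[of m] Ck_continuous unfolding Cc_infty_iff by blast
  then have Gm [measurable]: "G m \<in> borel_measurable borel" for m
    by (rule borel_measurable_continuous_onI)
  have intw: "integrable lborel (\<lambda>x. indicator (cball 0 (real n + 2)) x * \<bar>D x\<bar>)"
    using D integrable_norm[of lborel "\<lambda>x. indicator (cball 0 (real n + 2)) x *\<^sub>R D x"]
    by (simp add: L1_loc_def set_integrable_def abs_mult)
  have "(\<lambda>m. \<integral>x. G m x * D x \<partial>lborel) \<longlonglongrightarrow> (\<integral>x. \<sigma> x * D x \<partial>lborel)"
  proof (rule integral_dominated_convergence[OF _ _ intw])
    show "(\<lambda>x. \<sigma> x * D x) \<in> borel_measurable lborel" using \<sigma>m by measurable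
    show "(\<lambda>x. G m x * D x) \<in> borel_measurable lborel" for m by measurable
    show "AE x in lborel. (\<lambda>m. G m x * D x) \<longlonglongrightarrow> \<sigma> x * D x"
      using G(4) by eventually_elim (intro tendsto_intros)
    show "AE x in lborel. norm (G m x * D x) \<le> indicator (cball 0 (real n + 2)) x * \<bar>D x\<bar>" for m
    proof (rule AE_I2)
      fix x
      show "norm (G m x * D x) \<le> indicator (cball 0 (real n + 2)) x * \<bar>D x\<bar>"
        using G(3)[of x m] mult_right_mono[OF G(2)[of m x], of "\<bar>D x\<bar>"]
        by (cases "norm x > real n + 2") (auto simp: abs_mult)
    qed
  qed
  then have "(\<integral>x. \<sigma> x * D x \<partial>lborel) \<le> C"
    by (rule LIMSEQ_le_const2) (use test G(1,2) in blast)
  moreover have "\<sigma> x * D x = \<bar>D x\<bar> * indicator ?B x" for x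
    by (simp add: \<sigma>_def abs_sgn)
  moreover have "integrable lborel (\<lambda>x. \<bar>D x\<bar> * indicator ?B x)"
    using D integrable_norm[of lborel "\<lambda>x. indicator ?B x *\<^sub>R D x"]
    by (simp add: L1_loc_def set_integrable_def abs_mult mult.commute)
  then have "(\<integral>\<^sup>+x. ennreal (\<bar>D x\<bar> * indicator ?B x) \<partial>lborel) = ennreal (\<integral>x. \<bar>D x\<bar> * indicator ?B x \<partial>lborel)"
    by (intro nn_integral_eq_integral) auto
  ultimately show "(\<integral>\<^sup>+x. ennreal \<bar>D x\<bar> * indicator ?B x \<partial>lborel) \<le> ennreal C"
    by (simp add: ennreal_mult' ennreal_indicator ennreal_leI)
qed

text \<open>The bound for smooth test functions is a bound on all pairings of \<open>f(\<sqdot> + z) - f\<close> with them, hence on its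
\<open>L\<^sup>1\<close> norm.\<close>

lemma total_var_translation:
  fixes f :: "'a::euclidean_space \<Rightarrow> real"
  assumes f: "L1_loc f" and fin: "total_var f < \<infinity>"
  shows "(\<integral>\<^sup>+x. ennreal \<bar>f (x + z) - f x\<bar> \<partial>lborel) \<le> ennreal (norm z) * total_var f"
proof -
  let ?V = "enn2real (total_var f)"
  have fz: "L1_loc (\<lambda>x. f (x + z))" by (rule L1_loc_translate[OF f])
  have "L1_loc (\<lambda>x. f (x + z) - f x)"
    using f fz by (auto simp: L1_loc_def intro!: set_integral_diff)
  then have "(\<integral>\<^sup>+x. ennreal \<bar>f (x + z) - f x\<bar> \<partial>lborel) \<le> ennreal (norm z * ?V)"
  proof (rule nn_integral_abs_le_by_duality)
    fix g :: "'a \<Rightarrow> real" assume g: "g \<in> Cc_infty" "\<And>x. \<bar>g x\<bar> \<le> 1"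
    have gc: "continuous_on UNIV g" and gb: "bounded {x. g x \<noteq> 0}"
      using g(1) Ck_continuous unfolding Cc_infty_iff by blast+
    have [measurable]: "f \<in> borel_measurable borel" "g \<in> borel_measurable borel"
      using f gc by (auto simp: L1_loc_def intro: borel_measurable_continuous_onI)
    have "(\<integral>x. g x * (f (x + z) - f x) \<partial>lborel) = (\<integral>x. g x * f (x + z) \<partial>lborel) - (\<integral>x. g x * f x \<partial>lborel)"
      using integrable_kernel_L1_loc[OF fz gc gb, of 0] integrable_kernel_L1_loc[OF f gc gb, of 0]
      by (simp add: right_diff_distrib)
    also have "(\<integral>x. g x * f (x + z) \<partial>lborel) = (\<integral>x. g (x - z) * f x \<partial>lborel)"
      using integral_translate[of "\<lambda>x. g (x - z) * f x" z] by simp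
    also have "\<dots> - (\<integral>x. g x * f x \<partial>lborel) \<le> norm z * ?V"
      by (rule translation_test_le[OF f fin g])
    finally show "(\<integral>x. g x * (f (x + z) - f x) \<partial>lborel) \<le> norm z * ?V" .
  qed simp
  also have "\<dots> = ennreal (norm z) * total_var f"
    using fin by (simp add: ennreal_mult)
  finally show ?thesis .
qed

text \<open>The difference \<open>h - f\<close> is an average, with weight \<open>\<eta>\<close>, of the translation differences \<open>f(\<sqdot> + z) - f\<close> with
\<open>|z| \<le> e\<close>.\<close>

lemma mollified_L1_distance:
  fixes f :: "'a::euclidean_space \<Rightarrow> real"
  assumes f: "L1_loc f" and fin: "total_var f < \<infinity>" and \<eta>: "mollifier e \<eta>"
  shows "(\<integral>\<^sup>+x. ennreal \<bar>correlation \<eta> f x - f x\<bar> \<partial>lborel) \<le> ennreal e * total_var f"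
proof -
  have [measurable]: "f \<in> borel_measurable borel" "\<eta> \<in> borel_measurable borel"
    using f mollifierD(10)[OF \<eta>] by (auto simp: L1_loc_def)
  have \<eta>0: "\<eta> z \<ge> 0" for z by (rule mollifierD(5)[OF \<eta>])
  have pt: "ennreal \<bar>correlation \<eta> f x - f x\<bar> \<le> (\<integral>\<^sup>+z. ennreal (\<eta> z) * ennreal \<bar>f (x + z) - f x\<bar> \<partial>lborel)" for x
  proof -
    have int: "integrable lborel (\<lambda>y. \<eta> (y - x) * f y)"
      using integrable_kernel_L1_loc[OF f mollifierD(3,4)[OF \<eta>]] by simp
    have int': "integrable lborel (\<lambda>y. \<eta> (y - x) * f y - \<eta> (y - x) * f x)"
      by (intro Bochner_Integration.integrable_diff int integrable_mult_left mollifierD[OF \<eta>])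
    have "correlation \<eta> f x - f x = (\<integral>y. \<eta> (y - x) * f y \<partial>lborel) - (\<integral>y. \<eta> (y - x) * f x \<partial>lborel)"
      by (simp add: correlation_def mollifierD[OF \<eta>])
    also have "\<dots> = (\<integral>y. \<eta> (y - x) * f y - \<eta> (y - x) * f x \<partial>lborel)"
      by (intro Bochner_Integration.integral_diff[symmetric] int integrable_mult_left mollifierD[OF \<eta>])
    finally have "ennreal \<bar>correlation \<eta> f x - f x\<bar>
        = ennreal (norm (\<integral>y. \<eta> (y - x) * f y - \<eta> (y - x) * f x \<partial>lborel))" by simp
    also have "\<dots> \<le> (\<integral>\<^sup>+y. ennreal (norm (\<eta> (y - x) * f y - \<eta> (y - x) * f x)) \<partial>lborel)"
      by (rule integral_norm_bound_ennreal[OF int'])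
    also have "\<dots> = (\<integral>\<^sup>+y. ennreal (\<eta> (y - x)) * ennreal \<bar>f y - f x\<bar> \<partial>lborel)"
      by (simp add: right_diff_distrib[symmetric] abs_mult \<eta>0 ennreal_mult)
    also have "\<dots> = (\<integral>\<^sup>+z. ennreal (\<eta> z) * ennreal \<bar>f (x + z) - f x\<bar> \<partial>lborel)"
      using nn_integral_translate[of "\<lambda>y. ennreal (\<eta> (y - x)) * ennreal \<bar>f y - f x\<bar>" x]
      by (simp add: add.commute)
    finally show ?thesis .
  qed
  have "(\<integral>\<^sup>+x. ennreal \<bar>correlation \<eta> f x - f x\<bar> \<partial>lborel)
      \<le> (\<integral>\<^sup>+x. \<integral>\<^sup>+z. ennreal (\<eta> z) * ennreal \<bar>f (x + z) - f x\<bar> \<partial>lborel \<partial>lborel)"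
    by (intro nn_integral_mono pt)
  also have "\<dots> = (\<integral>\<^sup>+z. \<integral>\<^sup>+x. ennreal (\<eta> z) * ennreal \<bar>f (x + z) - f x\<bar> \<partial>lborel \<partial>lborel)"
    by (rule lborel_pair.Fubini'[symmetric]) measurable
  also have "\<dots> = (\<integral>\<^sup>+z. ennreal (\<eta> z) * (\<integral>\<^sup>+x. ennreal \<bar>f (x + z) - f x\<bar> \<partial>lborel) \<partial>lborel)"
    by (intro nn_integral_cong nn_integral_cmult) measurable
  also have "\<dots> \<le> (\<integral>\<^sup>+z. ennreal (\<eta> z) * (ennreal e * total_var f) \<partial>lborel)"
  proof (rule nn_integral_mono)
    fix z
    show "ennreal (\<eta> z) * (\<integral>\<^sup>+x. ennreal \<bar>f (x + z) - f x\<bar> \<partial>lborel) \<le> ennreal (\<eta> z) * (ennreal e * total_var f)"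
    proof (cases "\<eta> z = 0")
      case False
      then have "norm z \<le> e" by (rule mollifierD(7)[OF \<eta>])
      then have "ennreal (norm z) * total_var f \<le> ennreal e * total_var f"
        by (intro mult_right_mono ennreal_leI) auto
      with total_var_translation[OF f fin, of z] show ?thesis
        by (intro mult_left_mono) auto
    qed simp
  qed
  also have "\<dots> = (\<integral>\<^sup>+z. ennreal (\<eta> z) \<partial>lborel) * (ennreal e * total_var f)"
    by (rule nn_integral_multc) measurable
  also have "(\<integral>\<^sup>+z. ennreal (\<eta> z) \<partial>lborel) = 1"
    using nn_integral_eq_integral[OF mollifierD(8)[OF \<eta>]] \<eta>0 by (simp add: mollifierD[OF \<eta>])
  finally show ?thesis by simp
qed

section \<open>Coarea inequality for superlevel sets\<close>

text \<open>The function \<open>S\<close> of the coarea argument: smooth, zero on the negative half line, increasing to 1 at infinity.\<close>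

definition smooth_step :: "real \<Rightarrow> real" where
  "smooth_step = flat 1"

definition smooth_step_deriv :: "real \<Rightarrow> real" where
  "smooth_step_deriv = flat (flat_deriv 1)"

lemma smooth_step_bounds: "0 \<le> smooth_step u" "smooth_step u \<le> 1"
  by (auto simp: smooth_step_def flat_def)

lemma smooth_step_deriv_nonneg: "0 \<le> smooth_step_deriv u"
  by (auto simp: smooth_step_deriv_def flat_def)

lemma DERIV_smooth_step: "(smooth_step has_field_derivative smooth_step_deriv u) (at u)"
  unfolding smooth_step_def smooth_step_deriv_def by (rule DERIV_flat)

lemma smooth_step_deriv_measurable [measurable]: "smooth_step_deriv \<in> borel_measurable borel"
  unfolding smooth_step_deriv_def using Ck_flat[of 0] by (intro borel_measurable_continuous_onI) simp

lemma smooth_step_limit: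
  "(\<lambda>n. smooth_step (real (Suc n) * a)) \<longlonglongrightarrow> (if a > 0 then 1 else 0)"
proof (cases "a > 0")
  case True
  have "(\<lambda>n. exp (- (1 / a * inverse (real (Suc n))))) \<longlonglongrightarrow> exp (- (1 / a * 0))"
    by (intro tendsto_intros LIMSEQ_inverse_real_of_nat)
  moreover have "smooth_step (real (Suc n) * a) = exp (- (1 / a * inverse (real (Suc n))))" for n
    using True by (simp add: smooth_step_def flat_def divide_simps)
  ultimately show ?thesis using True by simp
next
  case False
  then have "smooth_step (real (Suc n) * a) = 0" for n
    by (simp add: smooth_step_def flat_def zero_less_mult_iff not_less)
  then show ?thesis using False by simp
qed

lemma gradient_smooth_step:
  assumes "Ck (Suc 0) h"
  shows "gradient (\<lambda>x. smooth_step (N * (h x + - s))) x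
    = (N * smooth_step_deriv (N * (h x + - s))) *\<^sub>R gradient h x"
proof -
  have "((\<lambda>x. N * (h x + - s)) has_derivative (\<lambda>v. N * frechet_derivative h (at x) v)) (at x)"
    using Ck_has_derivative[OF assms] by (auto intro!: derivative_eq_intros simp del: Ck.simps)
  from has_derivative_compose[OF this DERIV_smooth_step[unfolded has_field_derivative_def]]
  have "((\<lambda>x. smooth_step (N * (h x + - s))) has_derivative
     (\<lambda>v. smooth_step_deriv (N * (h x + - s)) * (N * frechet_derivative h (at x) v))) (at x)" .
  from frechet_derivative_at[OF this, symmetric] show ?thesis
    by (simp add: gradient_def scaleR_sum_right mult_ac)
qed

text \<open>The functions \<open>S(n(h - s))\<close> converge boundedly to the indicator of \<open>{h > s}\<close>. Integrating by parts before
passing to the limit replaces the divergence by the gradient of \<open>S(n(h - s))\<close>.\<close>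

lemma perimeter_superlevel_le:
  fixes h :: "'a::euclidean_space \<Rightarrow> real"
  assumes h: "Ck (Suc 0) h"
  shows "perimeter {x. s < h x} \<le> liminf (\<lambda>n. \<integral>\<^sup>+x. ennreal (real (Suc n) * smooth_step_deriv (real (Suc n) * (h x + - s)))
      * ennreal (norm (gradient h x)) \<partial>lborel)"
  unfolding perimeter_def
proof (rule total_var_le)
  let ?E = "{x. s < h x}"
  have hc: "continuous_on UNIV h" by (rule Ck_continuous[OF h])
  have "open ?E" using hc by (intro open_Collect_less continuous_intros)
  then have [measurable]: "?E \<in> sets borel" by simp
  show L: "L1_loc (indicat_real ?E)"
    by (rule L1_loc_bounded[of _ 1]) (auto simp: indicator_def)
  fix \<Phi> :: "'a \<Rightarrow> 'a" assume \<Phi>: "\<Phi> \<in> Cc_infty" "\<And>x. norm (\<Phi> x) \<le> 1"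
  let ?w = "\<lambda>n x. smooth_step (real (Suc n) * (h x + - s))"
  let ?a = "\<lambda>n. \<integral>x. ?w n x * div_field \<Phi> x \<partial>lborel"
  have Ckw: "Ck (Suc 0) (?w n)" for n
    unfolding smooth_step_def by (intro Ck_compose[OF Ck_flat] Ck_mult Ck_add Ck_const h)
  have wL: "L1_loc (?w n)" for n
    by (intro L1_loc_continuous Ck_continuous[OF Ckw])
  have int_div: "integrable lborel (div_field \<Phi>)"
    by (intro integrable_continuous_bounded_support div_field_continuous_bounded_support \<Phi>)
  have "?a \<longlonglongrightarrow> (\<integral>x. indicator ?E x * div_field \<Phi> x \<partial>lborel)"
  proof (rule integral_dominated_convergence)
    show "integrable lborel (\<lambda>x. \<bar>div_field \<Phi> x\<bar>)" by (rule integrable_abs[OF int_div])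
    show "(\<lambda>x. indicator ?E x * div_field \<Phi> x) \<in> borel_measurable lborel"
      using integrable_mult_div_field[OF L \<Phi>(1)] by (rule borel_measurable_integrable)
    show "(\<lambda>x. ?w n x * div_field \<Phi> x) \<in> borel_measurable lborel" for n
      using integrable_mult_div_field[OF wL \<Phi>(1)] by (rule borel_measurable_integrable)
    show "AE x in lborel. (\<lambda>n. ?w n x * div_field \<Phi> x) \<longlonglongrightarrow> indicator ?E x * div_field \<Phi> x"
    proof (rule AE_I2, rule tendsto_mult_right)
      fix x
      show "(\<lambda>n. ?w n x) \<longlonglongrightarrow> indicator ?E x"
        using smooth_step_limit[of "h x + - s"] by (cases "s < h x") (simp_all add: indicator_def)
    qed
    show "AE x in lborel. norm (?w n x * div_field \<Phi> x) \<le> \<bar>div_field \<Phi> x\<bar>" for n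
      using mult_right_mono[OF smooth_step_bounds(2) abs_ge_zero]
      by (intro AE_I2) (simp add: abs_mult smooth_step_bounds)
  qed
  then have "liminf (\<lambda>n. ennreal (?a n)) = ennreal (\<integral>x. indicator ?E x * div_field \<Phi> x \<partial>lborel)"
    by (intro lim_imp_Liminf tendsto_ennrealI) auto
  then have "ennreal (\<integral>x. indicator ?E x * div_field \<Phi> x \<partial>lborel) = liminf (\<lambda>n. ennreal (?a n))" ..
  also have "\<dots> \<le> liminf (\<lambda>n. \<integral>\<^sup>+x. ennreal (real (Suc n) * smooth_step_deriv (real (Suc n) * (h x + - s)))
      * ennreal (norm (gradient h x)) \<partial>lborel)"
  proof (intro Liminf_mono always_eventually allI)
    fix n
    have "?a n \<le> norm (\<integral>x. gradient (?w n) x \<bullet> \<Phi> x \<partial>lborel)"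
      using divergence_theorem_product(2)[OF Ckw \<Phi>(1)] by simp
    then have "ennreal (?a n) \<le> ennreal (norm (\<integral>x. gradient (?w n) x \<bullet> \<Phi> x \<partial>lborel))"
      by (rule ennreal_leI)
    also have "\<dots> \<le> (\<integral>\<^sup>+x. ennreal (norm (gradient (?w n) x \<bullet> \<Phi> x)) \<partial>lborel)"
      by (rule integral_norm_bound_ennreal[OF divergence_theorem_product(1)[OF Ckw \<Phi>(1)]])
    also have "\<dots> \<le> (\<integral>\<^sup>+x. ennreal (real (Suc n) * smooth_step_deriv (real (Suc n) * (h x + - s)))
      * ennreal (norm (gradient h x)) \<partial>lborel)"
    proof (rule nn_integral_mono)
      fix x
      have "norm (gradient (?w n) x \<bullet> \<Phi> x) \<le> norm (gradient (?w n) x) * norm (\<Phi> x)"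
        unfolding real_norm_def by (rule Cauchy_Schwarz_ineq2)
      also have "\<dots> \<le> norm (gradient (?w n) x) * 1"
        by (intro mult_left_mono \<Phi>) auto
      also have "\<dots> = (real (Suc n) * smooth_step_deriv (real (Suc n) * (h x + - s))) * norm (gradient h x)"
        by (simp only: gradient_smooth_step[OF h])
          (simp add: abs_mult smooth_step_deriv_nonneg del: of_nat_Suc)
      finally show "ennreal (norm (gradient (?w n) x \<bullet> \<Phi> x))
        \<le> ennreal (real (Suc n) * smooth_step_deriv (real (Suc n) * (h x + - s))) * ennreal (norm (gradient h x))"
        by (subst ennreal_mult[symmetric]) (auto simp: smooth_step_deriv_nonneg intro!: ennreal_leI)
    qed
    finally show "ennreal (?a n) \<le> (\<integral>\<^sup>+x. ennreal (real (Suc n) * smooth_step_deriv (real (Suc n) * (h x + - s)))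
      * ennreal (norm (gradient h x)) \<partial>lborel)" .
  qed
  finally show "ennreal (\<integral>x. indicat_real ?E x * div_field \<Phi> x \<partial>lborel) \<le> \<dots>" .
qed

text \<open>The integrand is the derivative in \<open>s\<close> of \<open>- S(N(c - s))\<close>, and \<open>S\<close> takes values in \<open>[0, 1]\<close>.\<close>

lemma nn_integral_smooth_step_deriv_le:
  assumes "N \<ge> 0"
  shows "(\<integral>\<^sup>+s. ennreal (N * smooth_step_deriv (N * (c + - s))) * indicator {0..1} s \<partial>lborel) \<le> 1"
proof -
  have "(\<integral>\<^sup>+s. ennreal (N * smooth_step_deriv (N * (c + - s))) * indicator {0..1} s \<partial>lborel)
      = ennreal (- smooth_step (N * (c + - 1)) - (- smooth_step (N * (c + - 0))))"
  proof (rule nn_integral_FTC_Icc)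
    show "((\<lambda>s. - smooth_step (N * (c + - s))) has_real_derivative N * smooth_step_deriv (N * (c + - s))) (at s)" for s
    proof -
      have "((\<lambda>s. N * (c + - s)) has_real_derivative - N) (at s)"
        by (auto intro!: derivative_eq_intros)
      from DERIV_minus[OF DERIV_chain2[OF DERIV_smooth_step this]] show ?thesis
        by (simp add: mult.commute)
    qed
  qed (use assms smooth_step_deriv_nonneg in auto)
  also have "\<dots> \<le> ennreal 1"
    using smooth_step_bounds(1)[of "N * (c + - 1)"] smooth_step_bounds(2)[of "N * (c + - 0)"]
    by (intro ennreal_leI) simp
  finally show ?thesis by simp
qed

text \<open>Fatou's lemma and Tonelli's theorem applied to the previous two estimates. The bound is stated for a
majorant \<open>p\<close> of the perimeters, the lower limit of the gradient integrals, whose measurability in \<open>s\<close> is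
evident from the formula.\<close>

lemma coarea_inequality:
  fixes h :: "'a::euclidean_space \<Rightarrow> real"
  assumes h: "Ck (Suc 0) h"
  obtains p where "p \<in> borel_measurable borel" "\<And>s. perimeter {x. s < h x} \<le> p s"
    "(\<integral>\<^sup>+s. p s * indicator {0..1} s \<partial>lborel) \<le> (\<integral>\<^sup>+x. ennreal (norm (gradient h x)) \<partial>lborel)"
proof
  have [measurable]: "h \<in> borel_measurable borel" "gradient h \<in> borel_measurable borel"
    using Ck_continuous[OF h] continuous_gradient[OF h] by (auto intro: borel_measurable_continuous_onI)
  let ?Q = "\<lambda>n s x. ennreal (real (Suc n) * smooth_step_deriv (real (Suc n) * (h x + - s)))
      * ennreal (norm (gradient h x))"
  have Qm: "(\<lambda>s. \<integral>\<^sup>+x. ?Q n s x \<partial>lborel) \<in> borel_measurable borel" for n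
  proof -
    have "(\<lambda>s. \<integral>\<^sup>+x. ?Q n s x \<partial>lborel) \<in> borel_measurable lborel"
      by (rule lborel.borel_measurable_nn_integral) measurable
    then show ?thesis by simp
  qed
  let ?p = "\<lambda>s. liminf (\<lambda>n. \<integral>\<^sup>+x. ?Q n s x \<partial>lborel)"
  show "?p \<in> borel_measurable borel" using Qm by measurable
  show "perimeter {x. s < h x} \<le> ?p s" for s by (rule perimeter_superlevel_le[OF h])
  have "(\<integral>\<^sup>+s. ?p s * indicator {0..1} s \<partial>lborel)
      = (\<integral>\<^sup>+s. liminf (\<lambda>n. (\<integral>\<^sup>+x. ?Q n s x \<partial>lborel) * indicator {0..1} s) \<partial>lborel)"
    by (intro nn_integral_cong) (auto simp: indicator_def Liminf_const)
  also have "\<dots> \<le> liminf (\<lambda>n. \<integral>\<^sup>+s. (\<integral>\<^sup>+x. ?Q n s x \<partial>lborel) * indicator {0..1} s \<partial>lborel)"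
    using Qm by (intro nn_integral_liminf) measurable
  also have "\<dots> \<le> liminf (\<lambda>n. \<integral>\<^sup>+x. ennreal (norm (gradient h x)) \<partial>lborel)"
  proof (intro Liminf_mono always_eventually allI)
    fix n
    have "(\<integral>\<^sup>+s. (\<integral>\<^sup>+x. ?Q n s x \<partial>lborel) * indicator {0..1} s \<partial>lborel)
        = (\<integral>\<^sup>+s. \<integral>\<^sup>+x. ?Q n s x * indicator {0..1} s \<partial>lborel \<partial>lborel)"
      by (intro nn_integral_cong nn_integral_multc[symmetric]) measurable
    also have "\<dots> = (\<integral>\<^sup>+x. \<integral>\<^sup>+s. ?Q n s x * indicator {0..1} s \<partial>lborel \<partial>lborel)"
      by (rule lborel_pair.Fubini'[symmetric]) measurable
    also have "\<dots> = (\<integral>\<^sup>+x. \<integral>\<^sup>+s. ennreal (norm (gradient h x)) *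
        (ennreal (real (Suc n) * smooth_step_deriv (real (Suc n) * (h x + - s))) * indicator {0..1} s) \<partial>lborel \<partial>lborel)"
      by (simp only: mult_ac)
    also have "\<dots> = (\<integral>\<^sup>+x. ennreal (norm (gradient h x)) * (\<integral>\<^sup>+s.
        ennreal (real (Suc n) * smooth_step_deriv (real (Suc n) * (h x + - s))) * indicator {0..1} s \<partial>lborel) \<partial>lborel)"
      by (intro nn_integral_cong nn_integral_cmult) measurable
    also have "\<dots> \<le> (\<integral>\<^sup>+x. ennreal (norm (gradient h x)) * 1 \<partial>lborel)"
      by (intro nn_integral_mono mult_left_mono nn_integral_smooth_step_deriv_le) auto
    finally show "(\<integral>\<^sup>+s. (\<integral>\<^sup>+x. ?Q n s x \<partial>lborel) * indicator {0..1} s \<partial>lborel)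
        \<le> (\<integral>\<^sup>+x. ennreal (norm (gradient h x)) \<partial>lborel)" by simp
  qed
  also have "\<dots> = (\<integral>\<^sup>+x. ennreal (norm (gradient h x)) \<partial>lborel)" by (simp add: Liminf_const)
  finally show "(\<integral>\<^sup>+s. ?p s * indicator {0..1} s \<partial>lborel) \<le> (\<integral>\<^sup>+x. ennreal (norm (gradient h x)) \<partial>lborel)" .
qed

section \<open>Comparison of the two functionals\<close>

text \<open>For \<open>a\<close> equal to 0 or 1, the levels \<open>s\<close> in \<open>[0, 1]\<close> at which \<open>a\<close> and the indicator of \<open>s < c\<close> differ all lie
between \<open>a\<close> and \<open>c\<close>.\<close>

lemma layer_cake_pointwise:
  fixes a c :: real
  assumes "a = 0 \<or> a = 1"
  shows "(\<integral>\<^sup>+s. ennreal \<bar>a - of_bool (s < c)\<bar> * indicator {0..1} s \<partial>lborel) \<le> ennreal \<bar>a - c\<bar>"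
proof -
  consider "a = 0" "c < 0" | "a = 0" "c \<ge> 0" | "a = 1" "c > 1" | "a = 1" "c \<le> 1"
    using assms by linarith
  then show ?thesis
  proof cases
    case 1
    then have "(\<integral>\<^sup>+s. ennreal \<bar>a - of_bool (s < c)\<bar> * indicator {0..1} s \<partial>lborel) = (\<integral>\<^sup>+s. 0 \<partial>(lborel :: real measure))"
      by (intro nn_integral_cong) (auto simp: indicator_def)
    then show ?thesis by simp
  next
    case 2
    then have "(\<integral>\<^sup>+s. ennreal \<bar>a - of_bool (s < c)\<bar> * indicator {0..1} s \<partial>lborel) \<le> (\<integral>\<^sup>+s. indicator {0..c} s \<partial>lborel)"
      by (intro nn_integral_mono) (auto simp: indicator_def)
    then show ?thesis using 2 by simp
  next
    case 3
    then have "(\<integral>\<^sup>+s. ennreal \<bar>a - of_bool (s < c)\<bar> * indicator {0..1} s \<partial>lborel) = (\<integral>\<^sup>+s. 0 \<partial>(lborel :: real measure))"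
      by (intro nn_integral_cong) (auto simp: indicator_def)
    then show ?thesis by simp
  next
    case 4
    then have "(\<integral>\<^sup>+s. ennreal \<bar>a - of_bool (s < c)\<bar> * indicator {0..1} s \<partial>lborel) \<le> (\<integral>\<^sup>+s. indicator {c..1} s \<partial>lborel)"
      by (intro nn_integral_mono) (auto simp: indicator_def)
    then show ?thesis using 4 by simp
  qed
qed

lemma nn_integral_sym_diff:
  assumes "A \<in> sets M" "U \<in> sets M"
  shows "(\<integral>\<^sup>+x. ennreal \<bar>indicat_real A x - indicat_real U x\<bar> \<partial>M) = emeasure M (sym_diff A U)"
proof -
  have "(\<integral>\<^sup>+x. ennreal \<bar>indicat_real A x - indicat_real U x\<bar> \<partial>M) = (\<integral>\<^sup>+x. indicator (sym_diff A U) x \<partial>M)"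
    by (intro nn_integral_cong) (auto simp: indicator_def)
  then show ?thesis using assms by simp
qed

text \<open>The superlevel sets of \<open>h\<close> are open, so the penalty functional is at most their cost at every level
\<open>s\<close>; integrating this over \<open>[0, 1]\<close> and applying the layer cake bound and the coarea inequality gives the
claim.\<close>

lemma K_penalty_le_smooth:
  fixes h :: "'a::euclidean_space \<Rightarrow> real"
  assumes A: "A \<in> sets borel" and h: "Ck (Suc 0) h" and t: "t > 0"
  shows "K_penalty t A \<le> (\<integral>\<^sup>+x. ennreal \<bar>indicat_real A x - h x\<bar> \<partial>lborel)
    + ennreal t * (\<integral>\<^sup>+x. ennreal (norm (gradient h x)) \<partial>lborel)"
proof -
  have hc: "continuous_on UNIV h" by (rule Ck_continuous[OF h])
  have [measurable]: "h \<in> borel_measurable borel" "A \<in> sets borel"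
    using hc A by (auto intro: borel_measurable_continuous_onI)
  obtain p where [measurable]: "p \<in> borel_measurable borel"
    and p: "\<And>s. perimeter {x. s < h x} \<le> p s"
    and p_int: "(\<integral>\<^sup>+s. p s * indicator {0..1} s \<partial>lborel) \<le> (\<integral>\<^sup>+x. ennreal (norm (gradient h x)) \<partial>lborel)"
    by (rule coarea_inequality[OF h]) (rule that)
  let ?u = "\<lambda>s. \<integral>\<^sup>+x. ennreal \<bar>indicat_real A x - of_bool (s < h x)\<bar> \<partial>lborel"
  have um: "?u \<in> borel_measurable borel"
  proof -
    have "?u \<in> borel_measurable lborel"
      by (rule lborel.borel_measurable_nn_integral) measurable
    then show ?thesis by simp
  qed
  have level: "K_penalty t A \<le> ?u s + ennreal t * p s" for s
  proof (cases "perimeter {x. s < h x} < \<infinity>")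
    case True
    have op: "open {x. s < h x}" using hc by (intro open_Collect_less continuous_intros)
    have "K_penalty t A \<le> emeasure lebesgue (sym_diff A {x. s < h x}) + ennreal t * perimeter {x. s < h x}"
      unfolding K_penalty_def by (rule INF_lower) (use True op in simp)
    also have "emeasure lebesgue (sym_diff A {x. s < h x})
        = (\<integral>\<^sup>+x. ennreal \<bar>indicat_real A x - indicat_real {x. s < h x} x\<bar> \<partial>lebesgue)"
      using op A by (intro nn_integral_sym_diff[symmetric]) auto
    also have "\<dots> = ?u s"
      by (simp add: nn_integral_completion indicator_def)
    also have "?u s + ennreal t * perimeter {x. s < h x} \<le> ?u s + ennreal t * p s"
      by (intro add_left_mono mult_left_mono p) auto
    finally show ?thesis .
  next
    case False
    \<comment> \<open>the level set is then no competitor, but \<open>t > 0\<close> makes the right-hand side infinite\<close>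
    then have "p s = \<infinity>" using p[of s] by (simp add: not_less top_unique)
    then show ?thesis using t by (simp add: ennreal_mult_top)
  qed
  \<comment> \<open>the constant is its own average over the levels in \<open>[0, 1]\<close>\<close>
  have "K_penalty t A = (\<integral>\<^sup>+s. K_penalty t A * indicator {0..1::real} s \<partial>lborel)"
    by (subst nn_integral_cmult) auto
  also have "\<dots> \<le> (\<integral>\<^sup>+s. ?u s * indicator {0..1} s + ennreal t * (p s * indicator {0..1} s) \<partial>lborel)"
    using level by (intro nn_integral_mono) (auto simp: indicator_def)
  also have "\<dots> = (\<integral>\<^sup>+s. ?u s * indicator {0..1} s \<partial>lborel) + ennreal t * (\<integral>\<^sup>+s. p s * indicator {0..1} s \<partial>lborel)"
    using um by (subst nn_integral_add) (auto simp: nn_integral_cmult)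
  also have "(\<integral>\<^sup>+s. ?u s * indicator {0..1} s \<partial>lborel)
      = (\<integral>\<^sup>+s. \<integral>\<^sup>+x. ennreal \<bar>indicat_real A x - of_bool (s < h x)\<bar> * indicator {0..1} s \<partial>lborel \<partial>lborel)"
    by (intro nn_integral_cong nn_integral_multc[symmetric]) measurable
  also have "\<dots> = (\<integral>\<^sup>+x. \<integral>\<^sup>+s. ennreal \<bar>indicat_real A x - of_bool (s < h x)\<bar> * indicator {0..1} s \<partial>lborel \<partial>lborel)"
    by (rule lborel_pair.Fubini'[symmetric]) measurable
  also have "\<dots> \<le> (\<integral>\<^sup>+x. ennreal \<bar>indicat_real A x - h x\<bar> \<partial>lborel)"
    by (intro nn_integral_mono layer_cake_pointwise) (auto simp: indicator_def)
  also have "ennreal t * (\<integral>\<^sup>+s. p s * indicator {0..1} s \<partial>lborel)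
      \<le> ennreal t * (\<integral>\<^sup>+x. ennreal (norm (gradient h x)) \<partial>lborel)"
    by (intro mult_left_mono p_int) auto
  finally show ?thesis by (simp add: add_mono)
qed

text \<open>The previous bound for mollifications of \<open>f\<close>. Passing from \<open>f\<close> to its mollification at scale \<open>e\<close>
costs at most \<open>e |Df|\<close>, which is arbitrarily small.\<close>

lemma K_penalty_le_borel:
  fixes f :: "'a::euclidean_space \<Rightarrow> real"
  assumes A: "A \<in> sets borel" and f: "L1_loc f" and fin: "total_var f < \<infinity>" and t: "t > 0"
  shows "K_penalty t A \<le> (\<integral>\<^sup>+x. ennreal \<bar>indicat_real A x - f x\<bar> \<partial>lborel) + ennreal t * total_var f"
proof -
  let ?F = "\<integral>\<^sup>+x. ennreal \<bar>indicat_real A x - f x\<bar> \<partial>lborel"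
  let ?V = "total_var f"
  have [measurable]: "f \<in> borel_measurable borel" "A \<in> sets borel"
    using f A by (auto simp: L1_loc_def)
  have approx: "K_penalty t A \<le> (?F + ennreal t * ?V) + ennreal e * ?V" if e: "e > 0" for e
  proof -
    obtain \<eta> :: "'a \<Rightarrow> real" where \<eta>: "mollifier e \<eta>" using mollifier_exists[OF e] by blast
    let ?h = "correlation \<eta> f"
    have Ckh: "Ck (Suc 0) ?h" by (rule Ck_correlation[OF f mollifierD(1)[OF \<eta>]])
    have [measurable]: "?h \<in> borel_measurable borel"
      by (rule borel_measurable_continuous_onI[OF Ck_continuous[OF Ckh]])
    have "K_penalty t A \<le> (\<integral>\<^sup>+x. ennreal \<bar>indicat_real A x - ?h x\<bar> \<partial>lborel)
        + ennreal t * (\<integral>\<^sup>+x. ennreal (norm (gradient ?h x)) \<partial>lborel)"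
      by (rule K_penalty_le_smooth[OF A Ckh t])
    also have "\<dots> \<le> (\<integral>\<^sup>+x. ennreal \<bar>indicat_real A x - f x\<bar> + ennreal \<bar>?h x - f x\<bar> \<partial>lborel) + ennreal t * ?V"
    proof (intro add_mono mult_left_mono nn_integral_mono integral_norm_gradient_mollified_le[OF f \<eta>])
      show "ennreal \<bar>indicat_real A x - ?h x\<bar> \<le> ennreal \<bar>indicat_real A x - f x\<bar> + ennreal \<bar>?h x - f x\<bar>" for x
      proof -
        have "\<bar>indicat_real A x - ?h x\<bar> \<le> \<bar>indicat_real A x - f x\<bar> + \<bar>?h x - f x\<bar>" by linarith
        from ennreal_leI[OF this] show ?thesis by simp
      qed
    qed simp
    also have "(\<integral>\<^sup>+x. ennreal \<bar>indicat_real A x - f x\<bar> + ennreal \<bar>?h x - f x\<bar> \<partial>lborel)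
        = ?F + (\<integral>\<^sup>+x. ennreal \<bar>?h x - f x\<bar> \<partial>lborel)"
      by (rule nn_integral_add) measurable
    also have "\<dots> + ennreal t * ?V \<le> ?F + ennreal e * ?V + ennreal t * ?V"
      by (intro add_mono mollified_L1_distance[OF f fin \<eta>]) auto
    finally show ?thesis by (simp add: add_ac)
  qed
  show ?thesis
  proof (rule ennreal_le_epsilon)
    fix e :: real assume e: "e > 0"
    define v where "v = enn2real ?V"
    have v: "?V = ennreal v" "v \<ge> 0" using fin by (auto simp: v_def)
    \<comment> \<open>scale \<open>e / (v + 1)\<close>, since \<open>v\<close> may be 0\<close>
    have "K_penalty t A \<le> (?F + ennreal t * ?V) + ennreal (e / (v + 1)) * ?V"
      using e v by (intro approx) auto
    also have "ennreal (e / (v + 1)) * ?V = ennreal (e / (v + 1) * v)"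
      using e v by (simp add: ennreal_mult'[symmetric] mult.commute)
    also have "\<dots> \<le> ennreal e"
      using e v(2) by (intro ennreal_leI) (simp add: field_simps)
    finally show "K_penalty t A \<le> ?F + ennreal t * ?V + ennreal e"
      by (simp add: add_left_mono)
  qed
qed

lemma L1_loc_imp_loc_integrable:
  assumes f: "L1_loc f"
  shows "loc_integrable f"
  unfolding loc_integrable_def set_integrable_def
proof safe
  fix C :: "'a set" assume "compact C"
  then have [measurable]: "C \<in> sets borel" and b: "bounded C"
    by (auto intro: borel_compact compact_imp_bounded)
  have "integrable lborel (\<lambda>x. indicat_real C x *\<^sub>R f x)"
    by (rule integrable_scaleR_L1_loc[OF f, of _ 1])
      (auto simp: indicator_def intro: bounded_subset[OF b])
  then show "integrable lebesgue (\<lambda>x. indicat_real C x *\<^sub>R f x)"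
    by (subst integrable_completion) auto
qed

lemma loc_integrable_borel_version:
  fixes f :: "'a::euclidean_space \<Rightarrow> real"
  assumes f: "loc_integrable f"
  obtains g where "L1_loc g" "AE x in lebesgue. f x = g x" "total_var g = total_var f"
proof -
  have int: "integrable lebesgue (\<lambda>x. indicat_real (cball 0 r) x * f x)" for r
    using f by (simp add: loc_integrable_def set_integrable_def)
  have fm: "f \<in> borel_measurable lebesgue"
  proof (rule borel_measurable_LIMSEQ_real)
    show "(\<lambda>x. indicat_real (cball 0 (real n)) x * f x) \<in> borel_measurable lebesgue" for n
      using int by (rule borel_measurable_integrable)
    show "(\<lambda>n. indicat_real (cball 0 (real n)) x * f x) \<longlonglongrightarrow> f x" for x
    proof (rule tendsto_eventually)
      obtain m where "norm x \<le> real m" using real_arch_simple by blast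
      then show "\<forall>\<^sub>F n in sequentially. indicat_real (cball 0 (real n)) x * f x = f x"
        unfolding eventually_sequentially by (intro exI[of _ m]) auto
    qed
  qed
  then obtain g where g [measurable]: "g \<in> borel_measurable lborel" and ae: "AE x in lborel. f x = g x"
    using completion_ex_borel_measurable_real by blast
  have ae': "AE x in lebesgue. f x = g x" using ae by (simp add: AE_completion_iff)
  have gm: "g \<in> borel_measurable borel" "g \<in> borel_measurable lebesgue"
    using g by (auto intro: measurable_completion)
  have "set_integrable lborel (cball 0 r) g" for r
  proof -
    have "integrable lebesgue (\<lambda>x. indicat_real (cball 0 r) x * g x)"
    proof (rule integrable_cong_AE_imp[OF int])
      show "(\<lambda>x. indicat_real (cball 0 r) x * g x) \<in> borel_measurable lebesgue"
        by (intro borel_measurable_times borel_measurable_indicator gm) auto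
    qed (use ae' in auto)
    moreover have "(\<lambda>x. indicat_real (cball 0 r) x * g x) \<in> borel_measurable lborel"
      by (intro borel_measurable_times borel_measurable_indicator g) auto
    ultimately show ?thesis by (simp add: set_integrable_def integrable_completion)
  qed
  then have gL: "L1_loc g" using gm by (simp add: L1_loc_def)
  moreover have "total_var g = total_var f"
    unfolding total_var_def
  proof (rule SUP_cong[OF refl])
    fix \<Phi> :: "'a \<Rightarrow> 'a" assume "\<Phi> \<in> {\<Phi> \<in> Cc_infty. \<forall>x. norm (\<Phi> x) \<le> 1}"
    then have "div_field \<Phi> \<in> borel_measurable borel"
      by (intro borel_measurable_continuous_onI div_field_continuous_bounded_support) auto
    then have "div_field \<Phi> \<in> borel_measurable lebesgue"
      by (intro measurable_completion) simp
    then have "(LINT x|lebesgue. g x * div_field \<Phi> x) = (LINT x|lebesgue. f x * div_field \<Phi> x)"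
      using ae' by (intro integral_cong_AE borel_measurable_times gm fm) auto
    then show "ennreal (LINT x|lebesgue. g x * div_field \<Phi> x) = ennreal (LINT x|lebesgue. f x * div_field \<Phi> x)"
      by simp
  qed
  ultimately show ?thesis using that ae' by blast
qed

text \<open>Neither the penalty functional nor the total variation notices null sets, so \<open>A\<close> and \<open>f2\<close> may be replaced by Borel versions.\<close>

lemma K_penalty_le_decomposition:
  fixes A :: "'a::euclidean_space set"
  assumes A: "A \<in> sets lebesgue" and t: "t > 0"
    and f2: "f2 \<in> BV_dot" and dec: "AE x in lebesgue. indicat_real A x = f1 x + f2 x"
  shows "K_penalty t A \<le> (\<integral>\<^sup>+x. ennreal \<bar>f1 x\<bar> \<partial>lebesgue) + ennreal t * total_var f2"
proof -
  obtain g where g: "L1_loc g" "AE x in lebesgue. f2 x = g x" "total_var g = total_var f2"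
    using f2 loc_integrable_borel_version[of f2] by (auto simp: BV_dot_def)
  obtain S N N' where SN: "A = S \<union> N" "N \<subseteq> N'" "N' \<in> null_sets lborel" "S \<in> sets lborel"
    by (rule sets_completionE[OF A])
  have "AE x in lborel. x \<notin> N'" using SN(3) by (rule AE_not_in)
  then have "AE x in lborel. x \<in> A \<longleftrightarrow> x \<in> S" by eventually_elim (use SN in auto)
  then have ae: "AE x in lebesgue. x \<in> A \<longleftrightarrow> x \<in> S" by (simp add: AE_completion_iff)
  have S: "S \<in> sets borel" "S \<in> sets lebesgue" using SN(4) by auto
  have "K_penalty t A = K_penalty t S"
    unfolding K_penalty_def
  proof (rule INF_cong[OF refl])
    fix U :: "'a set" assume "U \<in> {U. open U \<and> perimeter U < \<infinity>}"
    then have U: "U \<in> sets lebesgue" by auto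
    have "emeasure lebesgue (sym_diff A U) = emeasure lebesgue (sym_diff S U)"
    proof (rule emeasure_eq_AE)
      show "AE x in lebesgue. x \<in> sym_diff A U \<longleftrightarrow> x \<in> sym_diff S U"
        using ae by eventually_elim auto
    qed (intro sets.Un sets.Diff A S(2) U)+
    then show "emeasure lebesgue (sym_diff A U) + ennreal t * perimeter U
        = emeasure lebesgue (sym_diff S U) + ennreal t * perimeter U" by simp
  qed
  also have "\<dots> \<le> (\<integral>\<^sup>+x. ennreal \<bar>indicat_real S x - g x\<bar> \<partial>lborel) + ennreal t * total_var g"
    using f2 g by (intro K_penalty_le_borel S t) (auto simp: BV_dot_def)
  also have "(\<integral>\<^sup>+x. ennreal \<bar>indicat_real S x - g x\<bar> \<partial>lborel) = (\<integral>\<^sup>+x. ennreal \<bar>indicat_real S x - g x\<bar> \<partial>lebesgue)"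
    by (rule nn_integral_completion[symmetric])
  also have "\<dots> = (\<integral>\<^sup>+x. ennreal \<bar>f1 x\<bar> \<partial>lebesgue)"
  proof (rule nn_integral_cong_AE)
    show "AE x in lebesgue. ennreal \<bar>indicat_real S x - g x\<bar> = ennreal \<bar>f1 x\<bar>"
      using ae g(2) dec by eventually_elim (auto simp: indicator_def split: if_splits)
  qed
  finally show ?thesis by (simp only: g(3))
qed

text \<open>The decomposition into \<open>\<chi>\<^sub>A - \<chi>\<^sub>U\<close> and \<open>\<chi>\<^sub>U\<close>. When \<open>|A \<triangle> U|\<close> is infinite the first part is not integrable, but
then the bound is trivial.\<close>

lemma K_functional_le_open:
  fixes A :: "'a::euclidean_space set"
  assumes A: "A \<in> sets lebesgue" and U: "open U" "perimeter U < \<infinity>"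
  shows "K_functional t (indicat_real A) \<le> emeasure lebesgue (sym_diff A U) + ennreal t * perimeter U"
proof (cases "emeasure lebesgue (sym_diff A U) = \<infinity>")
  case False
  let ?f = "\<lambda>x. indicat_real A x - indicat_real U x"
  have Us: "U \<in> sets borel" "U \<in> sets lebesgue" using U(1) by auto
  have norm: "(\<integral>\<^sup>+x. ennreal \<bar>?f x\<bar> \<partial>lebesgue) = emeasure lebesgue (sym_diff A U)"
    by (rule nn_integral_sym_diff[OF A Us(2)])
  have "?f \<in> borel_measurable lebesgue"
    by (intro borel_measurable_diff borel_measurable_indicator A Us)
  moreover have "(\<integral>\<^sup>+x. ennreal (norm (?f x)) \<partial>lebesgue) < \<infinity>"
    using False by (simp only: real_norm_def norm) (simp add: less_top)
  ultimately have int: "integrable lebesgue ?f" by (rule integrableI_bounded)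
  have "L1_loc (indicat_real U)"
    using Us by (intro L1_loc_bounded[of _ 1]) (auto simp: indicator_def)
  then have "indicat_real U \<in> BV_dot"
    using U(2) by (simp add: BV_dot_def perimeter_def L1_loc_imp_loc_integrable)
  then have "K_functional t (indicat_real A)
      \<le> (case (?f, indicat_real U) of (f1, f2) \<Rightarrow> (\<integral>\<^sup>+x. ennreal \<bar>f1 x\<bar> \<partial>lebesgue) + ennreal t * total_var f2)"
    unfolding K_functional_def by (intro INF_lower) (use int in simp)
  then show ?thesis by (simp only: prod.case norm perimeter_def)
qed simp

theorem theorem3:
  fixes A :: "'a::euclidean_space set"
  assumes "A \<in> sets lebesgue"
  shows "(\<forall>t>0. K_functional t (indicat_real A) = K_penalty t A) \<and>
    (\<forall>\<alpha>\<in>{0<..<1}. frac_perimeter \<alpha> A =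
       ennreal (\<alpha> * (1 - \<alpha>)) *
         (\<integral>\<^sup>+t\<in>{0<..}. ennreal (t powr (- \<alpha>)) * K_penalty t A * ennreal (1 / t) \<partial>lborel))"
proof -
  have eq: "K_functional t (indicat_real A) = K_penalty t A" if "t > 0" for t
  proof (rule antisym)
    show "K_functional t (indicat_real A) \<le> K_penalty t A"
      unfolding K_penalty_def by (rule INF_greatest) (use K_functional_le_open[OF assms] in simp)
    show "K_penalty t A \<le> K_functional t (indicat_real A)"
      unfolding K_functional_def
      by (rule INF_greatest) (use K_penalty_le_decomposition[OF assms that] in auto)
  qed
  have "frac_perimeter \<alpha> A = ennreal (\<alpha> * (1 - \<alpha>)) *
      (\<integral>\<^sup>+t\<in>{0<..}. ennreal (t powr (- \<alpha>)) * K_penalty t A * ennreal (1 / t) \<partial>lborel)" for \<alpha>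
    unfolding frac_perimeter_def
    by (rule arg_cong[where f="(*) _"], rule nn_integral_cong) (auto simp: eq split: split_indicator)
  then show ?thesis using eq by blast
qed

end
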